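(* Let $K$ be either (a) the field $\mathbb{R}$ of real numbers, or (b) a number field admitting a real embedding $K\hookrightarrow\mathbb{R}$. Then it is impossible to choose, for every (connected) reductive $K$-group $G$, a group structure on the pointed set $H^1(K,G)$ such that: (i) the identity element of the group is the neutral element (class of the trivial cocycle) of $H^1(K,G)$; (ii) for every homomorphism of reductive $K$-groups $\varphi\colon G\to G'$, the induced map $\varphi_*\colon H^1(K,G)\to H^1(K,G')$ is a group homomorphism; and (iii) for every $K$-torus $T$, the chosen group structure on $H^1(K,T)$ coincides with the standard one (induced by pointwise multiplication of cocycles).
   Context: Reductive groups are assumed connected, and all algebraic groups are linear. For a field $K$ with separable closure $K^s$ and a $K$-group $G$, $H^1(K,G)$ is the first Galois cohomology set: the set of locally constant maps $c\colon \mathrm{Gal}(K^s/K)\to G(K^s)$ with $c(\gamma_1\gamma_2)=c(\gamma_1)\,{}^{\gamma_1}c(\gamma_2)$, modulo the equivalence $c'\sim c$ iff $c'(\gamma)=g^{-1}c(\gamma)\,{}^{\gamma}g$ for some $g\in G(K^s)$; it is a pointed set with distinguished element the class of the trivial cocycle. A homomorphism $\varphi\colon G\to H$ induces $\varphi_*$ sending the class of $c$ to the class of $\varphi\circ c$. When $T$ is a $K$-torus (commutative), the product of cocycles is a cocycle, giving the standard abelian group structure on $H^1(K,T)$. *)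

theory Defs
  imports
    "HOL-Analysis.Abstract_Topology"
    "HOL-Algebra.Coset"
    "HOL-Algebra.Algebraic_Closure_Type"
    "Jordan_Normal_Form.Matrix"
    "Jordan_Normal_Form.Determinant"
begin

text \<open>
  All fields \<open>K\<close> below have characteristic 0, so the separable closure \<open>K\<^sup>s\<close> is the algebraic
  closure (\<open>'k alg_closure\<close>, with \<open>to_ac\<close> the embedding of \<open>K\<close>), and linear algebraic \<open>K\<close>-groups
  are automatically smooth.  Such a group is presented as a subgroup of \<open>GL\<^sub>n(K\<^sup>s)\<close>, for some \<open>n\<close>,
  that is the zero locus of a set of functions in \<open>K[GL\<^sub>n]\<close>; a pair of \<open>n\<close> and the set of
  \<open>K\<^sup>s\<close>-points determines the group.
\<close>

section \<open>Linear algebraic groups\<close>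

definition GL :: "nat \<Rightarrow> ('a :: field) mat monoid"
  where "GL n = units_of (ring_mat TYPE('a) n ())"

text \<open>\<open>C[GL\<^sub>n]\<close> for a field of coefficients \<open>C\<close>: the \<open>C\<close>-algebra generated by the matrix entries
  and the inverse of the determinant.\<close>

inductive_set regular :: "('a :: field) set \<Rightarrow> nat \<Rightarrow> ('a mat \<Rightarrow> 'a) set"
  for C :: "'a set" and n :: nat
where
  const: "a \<in> C \<Longrightarrow> (\<lambda>_. a) \<in> regular C n"
| entry: "i < n \<Longrightarrow> j < n \<Longrightarrow> (\<lambda>A. A $$ (i, j)) \<in> regular C n"
| inv_det: "(\<lambda>A. inverse (det A)) \<in> regular C n"
| add: "f \<in> regular C n \<Longrightarrow> g \<in> regular C n \<Longrightarrow> (\<lambda>A. f A + g A) \<in> regular C n"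
| mult: "f \<in> regular C n \<Longrightarrow> g \<in> regular C n \<Longrightarrow> (\<lambda>A. f A * g A) \<in> regular C n"

text \<open>The Zariski \<open>C\<close>-topology on \<open>GL\<^sub>n\<close>: its closed sets are the zero loci of subsets of
  \<open>C[GL\<^sub>n]\<close>.  For \<open>C = UNIV\<close> this is the Zariski topology of the group over \<open>K\<^sup>s\<close>.\<close>

definition zariski :: "('a :: field) set \<Rightarrow> nat \<Rightarrow> 'a mat topology"
  where "zariski C n =
    topology_generated_by {{A \<in> carrier (GL n). f A \<noteq> 0} |f. f \<in> regular C n}"

definition alg_group :: "('a :: field) set \<Rightarrow> nat \<Rightarrow> 'a mat set \<Rightarrow> bool"
  where "alg_group C n G \<longleftrightarrow> subgroup G (GL n) \<and> closedin (zariski C n) G"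

definition alg_hom ::
    "('a :: field) set \<Rightarrow> nat \<Rightarrow> 'a mat set \<Rightarrow> nat \<Rightarrow> 'a mat set \<Rightarrow> ('a mat \<Rightarrow> 'a mat) \<Rightarrow> bool"
  where "alg_hom C m G n H \<phi> \<longleftrightarrow>
    \<phi> \<in> hom (GL m\<lparr>carrier := G\<rparr>) (GL n\<lparr>carrier := H\<rparr>) \<and>
    (\<forall>i<n. \<forall>j<n. \<exists>f\<in>regular C m. \<forall>A\<in>G. \<phi> A $$ (i, j) = f A)"

definition unipotent_mat :: "nat \<Rightarrow> ('a :: field) mat \<Rightarrow> bool"
  where "unipotent_mat n A \<longleftrightarrow> (\<exists>k. (A - 1\<^sub>m n) ^\<^sub>m k = 0\<^sub>m n n)"

abbreviation base_field :: "('k :: field_char_0) alg_closure set"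
  where "base_field \<equiv> range to_ac"

abbreviation K_group :: "nat \<Rightarrow> ('k :: field_char_0) alg_closure mat set \<Rightarrow> bool"
  where "K_group \<equiv> alg_group base_field"

text \<open>Connected, with trivial unipotent radical; connectedness and the unipotent radical are
  geometric, i.e. taken over \<open>K\<^sup>s\<close>.\<close>

definition reductive_group :: "nat \<Rightarrow> ('k :: field_char_0) alg_closure mat set \<Rightarrow> bool"
  where "reductive_group n G \<longleftrightarrow>
    K_group n G \<and> connectedin (zariski UNIV n) G \<and>
    (\<forall>U. alg_group UNIV n U \<and> connectedin (zariski UNIV n) U \<and>
         U \<lhd> (GL n\<lparr>carrier := G\<rparr>) \<and> (\<forall>u\<in>U. unipotent_mat n u)
       \<longrightarrow> U = {1\<^sub>m n})"

text \<open>The split torus of dimension \<open>d\<close>, i.e. the \<open>d\<close>-th power of the multiplicative group.\<close>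

definition diagonal_torus :: "nat \<Rightarrow> ('a :: field) mat set"
  where "diagonal_torus d = {A \<in> carrier (GL d). diagonal_mat A}"

text \<open>A \<open>K\<close>-group that becomes isomorphic to a split torus over \<open>K\<^sup>s\<close>.\<close>

definition torus :: "nat \<Rightarrow> ('k :: field_char_0) alg_closure mat set \<Rightarrow> bool"
  where "torus n T \<longleftrightarrow>
    K_group n T \<and>
    (\<exists>d \<phi> \<psi>. alg_hom UNIV n T d (diagonal_torus d) \<phi> \<and>
             alg_hom UNIV d (diagonal_torus d) n T \<psi> \<and>
             (\<forall>A\<in>T. \<psi> (\<phi> A) = A) \<and> (\<forall>D\<in>diagonal_torus d. \<phi> (\<psi> D) = D))"

section \<open>Galois cohomology\<close>

definition Gal :: "(('k :: field_char_0) alg_closure \<Rightarrow> 'k alg_closure) set"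
  where "Gal = {\<gamma>. bij \<gamma> \<and> field_hom \<gamma> \<and> (\<forall>a. \<gamma> (to_ac a) = to_ac a)}"

text \<open>Local constancy for the Krull topology: the sets of all \<open>\<gamma>'\<close> agreeing with \<open>\<gamma>\<close> on a finite set
  \<open>F\<close>, equivalently on the finite extension \<open>K(F)\<close>, form a neighbourhood base of \<open>\<gamma>\<close>.\<close>

definition locally_constant ::
    "((('k :: field_char_0) alg_closure \<Rightarrow> 'k alg_closure) \<Rightarrow> 'b) \<Rightarrow> bool"
  where "locally_constant c \<longleftrightarrow>
    (\<forall>\<gamma>\<in>Gal. \<exists>F. finite F \<and> (\<forall>\<gamma>'\<in>Gal. (\<forall>x\<in>F. \<gamma>' x = \<gamma> x) \<longrightarrow> c \<gamma>' = c \<gamma>))"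

type_synonym 'k cochain = "('k alg_closure \<Rightarrow> 'k alg_closure) \<Rightarrow> 'k alg_closure mat"

definition cocycles :: "('k :: field_char_0) alg_closure mat set \<Rightarrow> 'k cochain set"
  where "cocycles G = {c \<in> Gal \<rightarrow>\<^sub>E G. locally_constant c \<and>
    (\<forall>\<gamma>\<^sub>1\<in>Gal. \<forall>\<gamma>\<^sub>2\<in>Gal. c (\<gamma>\<^sub>1 \<circ> \<gamma>\<^sub>2) = c \<gamma>\<^sub>1 * map_mat \<gamma>\<^sub>1 (c \<gamma>\<^sub>2))}"

definition cohomologous ::
    "nat \<Rightarrow> ('k :: field_char_0) alg_closure mat set \<Rightarrow> ('k cochain \<times> 'k cochain) set"
  where "cohomologous n G = {(c, c'). c \<in> cocycles G \<and> c' \<in> cocycles G \<and>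
    (\<exists>g\<in>G. \<forall>\<gamma>\<in>Gal. c' \<gamma> = inv\<^bsub>GL n\<^esub> g * c \<gamma> * map_mat \<gamma> g)}"

definition H1 :: "nat \<Rightarrow> ('k :: field_char_0) alg_closure mat set \<Rightarrow> 'k cochain set set"
  where "H1 n G = cocycles G // cohomologous n G"

definition H1_class ::
    "nat \<Rightarrow> ('k :: field_char_0) alg_closure mat set \<Rightarrow> 'k cochain \<Rightarrow> 'k cochain set"
  where "H1_class n G c = cohomologous n G `` {c}"

definition trivial_cocycle :: "nat \<Rightarrow> ('k :: field_char_0) cochain"
  where "trivial_cocycle n = (\<lambda>\<gamma>\<in>Gal. 1\<^sub>m n)"

definition cocycle_mult ::
    "('k :: field_char_0) cochain \<Rightarrow> 'k cochain \<Rightarrow> 'k cochain"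
  where "cocycle_mult c d = (\<lambda>\<gamma>\<in>Gal. c \<gamma> * d \<gamma>)"

text \<open>The map on \<open>H\<^sup>1\<close> induced by \<open>\<phi>\<close>, with values in \<open>H\<^sup>1(K, H)\<close>: the cocycles \<open>\<phi> \<circ> c\<close> with \<open>c\<close> in the
  class \<open>\<xi>\<close> all lie in a single class, which is the value at \<open>\<xi>\<close>.\<close>

definition H1_map ::
    "nat \<Rightarrow> ('k :: field_char_0) alg_closure mat set \<Rightarrow>
     ('k alg_closure mat \<Rightarrow> 'k alg_closure mat) \<Rightarrow> 'k cochain set \<Rightarrow> 'k cochain set"
  where "H1_map n H \<phi> \<xi> = cohomologous n H `` (compose Gal \<phi> ` \<xi>)"

section \<open>The base field and the choice of group structures\<close>

definition is_real_field :: "('k :: field_char_0) itself \<Rightarrow> bool"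
  where "is_real_field _ \<longleftrightarrow> (\<exists>\<sigma> :: 'k \<Rightarrow> real. field_hom \<sigma> \<and> bij \<sigma>)"

definition is_number_field :: "('k :: field_char_0) itself \<Rightarrow> bool"
  where "is_number_field _ \<longleftrightarrow>
    (\<exists>B :: 'k set. finite B \<and> module.span (\<lambda>q x. of_rat q * x) B = UNIV)"

definition has_real_embedding :: "('k :: field_char_0) itself \<Rightarrow> bool"
  where "has_real_embedding _ \<longleftrightarrow> (\<exists>\<sigma> :: 'k \<Rightarrow> real. field_hom \<sigma>)"

text \<open>\<open>M\<close> chooses a group structure \<open>M n G\<close> on \<open>H\<^sup>1(K, G)\<close> for every reductive \<open>K\<close>-group \<open>G\<close> in
  \<open>GL\<^sub>n\<close>, subject to (i) neutral element, (ii) functoriality, (iii) compatibility on tori.\<close>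

definition functorial_group_structure ::
    "(nat \<Rightarrow> ('k :: field_char_0) alg_closure mat set \<Rightarrow> 'k cochain set monoid) \<Rightarrow> bool"
  where "functorial_group_structure M \<longleftrightarrow>
    (\<forall>n G. reductive_group n G \<longrightarrow>
       group (M n G) \<and> carrier (M n G) = H1 n G \<and>
       \<one>\<^bsub>M n G\<^esub> = H1_class n G (trivial_cocycle n)) \<and>
    (\<forall>m G n H \<phi>. reductive_group m G \<and> reductive_group n H \<and> alg_hom base_field m G n H \<phi> \<longrightarrow>
       H1_map n H \<phi> \<in> hom (M m G) (M n H)) \<and>
    (\<forall>n T. torus n T \<longrightarrow>
       (\<forall>c\<in>cocycles T. \<forall>d\<in>cocycles T.
          H1_class n T c \<otimes>\<^bsub>M n T\<^esub> H1_class n T d = H1_class n T (cocycle_mult c d)))"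

end

theory Submission
  imports
    Defs
    "HOL-Computational_Algebra.Fundamental_Theorem_Algebra"
    "Jordan_Normal_Form.Char_Poly"
begin

text \<open>
  Let \<open>G\<close> be the unitary group in two variables for \<open>K(\<surd>-1)/K\<close>, \<open>T\<close> its diagonal torus, and \<open>a\<close>,
  \<open>b\<close> the classes in \<open>H\<^sup>1(K, T)\<close> of the sign cocycle \<open>\<gamma> \<mapsto> \<gamma>(i)/i\<close> placed in the first and in the
  second coordinate.  Exchanging the coordinates is an inner automorphism of \<open>G\<close> over \<open>K\<close>, so \<open>a\<close> and
  \<open>b\<close> have the same image \<open>x\<close> in \<open>H\<^sup>1(K, G)\<close>.  If \<open>H\<^sup>1(K, T) \<rightarrow> H\<^sup>1(K, G)\<close> is a homomorphism, then
  \<open>a b\<close> and \<open>a\<^sup>2 = 1\<close> both map to \<open>x\<^sup>2\<close>, so the image of \<open>a b\<close> is trivial.  But this image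
  is the class of the negative definite Hermitian form, which differs from the positive definite one
  at a real embedding of \<open>K\<close>.
\<close>

section \<open>Complex conjugation on the algebraic closure\<close>

text \<open>Since \<open>i\<close> is not in K, the unitary group must be described without it.
  Writing K(i)^2 as K^4 turns K(i)-linearity into commuting with a matrix \<open>J4\<close> with
  entries 0, 1, -1, and turns the Hermitian adjoint into the transpose. Both groups then consist of
  orthogonal matrices commuting with such matrices, so one argument shows that they are K-groups and
  another that they are connected. Over K^s the matrix \<open>J4\<close> has two eigenspaces, on
  which a group element acts by 2x2 blocks; this gives the curves used for connectedness, the trace
  computations that exclude a unipotent radical, and the splitting of the torus. The sign cocycle
  has values 1 and -1, which are fixed by Galois, so the square of its class is trivial already on
  cocycles. For a number field K^s is not C, so complex conjugation must first be found as an
  element of the Galois group; this is why homomorphisms into an algebraically closed field have to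
  be extended to K^s.\<close>

definition partial_extension ::
    "('k :: field \<Rightarrow> 'c :: field) \<Rightarrow> ('k alg_closure \<times> 'c) set \<Rightarrow> bool"
  where "partial_extension \<sigma> \<Gamma> \<longleftrightarrow>
    (\<forall>a. (to_ac a, \<sigma> a) \<in> \<Gamma>) \<and>
    (\<forall>(a, b)\<in>\<Gamma>. \<forall>(c, d)\<in>\<Gamma>. (a + c, b + d) \<in> \<Gamma> \<and> (a * c, b * d) \<in> \<Gamma>) \<and>
    (\<forall>b. (0, b) \<in> \<Gamma> \<longrightarrow> b = 0)"

text \<open>A partial extension is the graph of a ring homomorphism from a subring of K^s, kept as a
  relation so that inclusion orders the extensions and unions of chains are again graphs. A
  coefficient pair is then a polynomial over that subring together with its image.\<close>

definition coeff_pairs :: "('a :: zero \<times> 'b :: zero) set \<Rightarrow> ('a poly \<times> 'b poly) set"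
  where "coeff_pairs \<Gamma> = {(P, Q). \<forall>i. (coeff P i, coeff Q i) \<in> \<Gamma>}"

context
  fixes \<sigma> :: "'k :: field \<Rightarrow> 'c :: field" and \<Gamma>
  assumes \<sigma>: "field_hom \<sigma>" and \<Gamma>: "partial_extension \<sigma> \<Gamma>"
begin

interpretation \<sigma>: field_hom \<sigma> by (rule \<sigma>)

lemma partial_extension_base: "(to_ac a, \<sigma> a) \<in> \<Gamma>"
  using \<Gamma> by (auto simp: partial_extension_def)

lemma partial_extension_0: "(0, 0) \<in> \<Gamma>"
  using partial_extension_base[of 0] by simp

lemma partial_extension_add: "(a, b) \<in> \<Gamma> \<Longrightarrow> (c, d) \<in> \<Gamma> \<Longrightarrow> (a + c, b + d) \<in> \<Gamma>"
  and partial_extension_mult: "(a, b) \<in> \<Gamma> \<Longrightarrow> (c, d) \<in> \<Gamma> \<Longrightarrow> (a * c, b * d) \<in> \<Gamma>"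
  using \<Gamma> by (auto simp: partial_extension_def)

lemma partial_extension_zero: "(0, b) \<in> \<Gamma> \<Longrightarrow> b = 0"
  using \<Gamma> by (auto simp: partial_extension_def)

lemma partial_extension_diff:
  assumes "(a, b) \<in> \<Gamma>" "(c, d) \<in> \<Gamma>" shows "(a - c, b - d) \<in> \<Gamma>"
proof -
  have "(-c, -d) \<in> \<Gamma>"
    using partial_extension_mult[OF partial_extension_base[of "-1"] assms(2)]
    by (simp add: \<sigma>.hom_uminus)
  from partial_extension_add[OF assms(1) this] show ?thesis by simp
qed

lemma partial_extension_sum:
  "(\<And>i. i \<in> A \<Longrightarrow> (f i, g i) \<in> \<Gamma>) \<Longrightarrow> (sum f A, sum g A) \<in> \<Gamma>"
  by (induction A rule: infinite_finite_induct)
    (auto intro: partial_extension_0 partial_extension_add)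

lemma partial_extension_single_valued: "(a, b) \<in> \<Gamma> \<Longrightarrow> (a, c) \<in> \<Gamma> \<Longrightarrow> b = c"
  using partial_extension_diff[of a b a c] partial_extension_zero by force

lemma partial_extension_poly:
  "(a, b) \<in> \<Gamma> \<Longrightarrow> (poly (map_poly to_ac p) a, poly (map_poly \<sigma> p) b) \<in> \<Gamma>"
  by (induction p) (auto simp: Polynomial.map_poly_pCons partial_extension_0
    intro!: partial_extension_add partial_extension_mult partial_extension_base)

text \<open>If \<open>a \<noteq> 0\<close>, then \<open>a\<close> is a root of a polynomial over the base field with nonzero constant
  term; carried over to \<open>0\<close>, this equation would make the constant term vanish.\<close>

lemma partial_extension_inj:
  assumes a0: "(a, 0) \<in> \<Gamma>"
  shows "a = 0"
proof (rule ccontr)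
  assume "a \<noteq> 0"
  have "p = 0" if "poly (map_poly to_ac p) a = 0" for p
    using that
  proof (induction p)
    case (pCons c q)
    have "(to_ac c + a * poly (map_poly to_ac q) a, \<sigma> c + 0 * poly (map_poly \<sigma> q) 0) \<in> \<Gamma>"
      by (intro partial_extension_add partial_extension_mult partial_extension_base
          partial_extension_poly a0)
    moreover have eval: "poly (map_poly to_ac (pCons c q)) a = to_ac c + a * poly (map_poly to_ac q) a"
      by (simp add: Polynomial.map_poly_pCons)
    ultimately have "(0, \<sigma> c) \<in> \<Gamma>" using pCons.prems by simp
    hence "\<sigma> c = 0" by (rule partial_extension_zero)
    hence "c = 0" by simp
    with pCons.prems \<open>a \<noteq> 0\<close> have "poly (map_poly to_ac q) a = 0"
      using eval by simp
    with pCons.IH \<open>c = 0\<close> show ?case by simp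
  qed simp
  thus False using alg_closure_algebraic[of a] by metis
qed

text \<open>The partial homomorphism is injective, so corresponding coefficients vanish
  together.\<close>

lemma coeff_pairs_degree:
  assumes "(P, Q) \<in> coeff_pairs \<Gamma>" shows "degree P = degree Q"
proof -
  have "coeff P i = 0 \<longleftrightarrow> coeff Q i = 0" for i
    using assms partial_extension_inj partial_extension_zero
    unfolding coeff_pairs_def by (metis (mono_tags, lifting) case_prodD mem_Collect_eq)
  thus ?thesis by (simp add: degree_def)
qed

lemma coeff_pairs_const: "(a, b) \<in> \<Gamma> \<Longrightarrow> ([:a:], [:b:]) \<in> coeff_pairs \<Gamma>"
  by (auto simp: coeff_pairs_def coeff_pCons partial_extension_0 split: nat.splits)

lemma coeff_pairs_X: "([:0, 1:], [:0, 1:]) \<in> coeff_pairs \<Gamma>"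
  using partial_extension_base[of 1]
  by (auto simp: coeff_pairs_def coeff_pCons partial_extension_0 split: nat.splits)

lemma coeff_pairs_add:
  "(P, Q) \<in> coeff_pairs \<Gamma> \<Longrightarrow> (R, S) \<in> coeff_pairs \<Gamma> \<Longrightarrow> (P + R, Q + S) \<in> coeff_pairs \<Gamma>"
  by (auto simp: coeff_pairs_def intro: partial_extension_add)

lemma coeff_pairs_diff:
  "(P, Q) \<in> coeff_pairs \<Gamma> \<Longrightarrow> (R, S) \<in> coeff_pairs \<Gamma> \<Longrightarrow> (P - R, Q - S) \<in> coeff_pairs \<Gamma>"
  by (auto simp: coeff_pairs_def intro: partial_extension_diff)

lemma coeff_pairs_mult:
  "(P, Q) \<in> coeff_pairs \<Gamma> \<Longrightarrow> (R, S) \<in> coeff_pairs \<Gamma> \<Longrightarrow> (P * R, Q * S) \<in> coeff_pairs \<Gamma>"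
  by (auto simp: coeff_pairs_def coeff_mult
      intro!: partial_extension_sum partial_extension_mult)

lemma coeff_pairs_monom: "(a, b) \<in> \<Gamma> \<Longrightarrow> (monom a n, monom b n) \<in> coeff_pairs \<Gamma>"
  by (auto simp: coeff_pairs_def partial_extension_0)

lemma coeff_pairs_map_poly: "(map_poly to_ac p, map_poly \<sigma> p) \<in> coeff_pairs \<Gamma>"
  by (auto simp: coeff_pairs_def coeff_map_poly partial_extension_base)

text \<open>\<open>P\<close> plays the minimal polynomial of \<open>x\<close>. Division with
  remainder is replaced by pseudo-division, because the domain of the partial homomorphism is only
  known to be a ring: \<open>A\<close> is multiplied by the leading coefficient of \<open>P\<close>
  instead of dividing by it.\<close>

lemma partial_extension_root:
  assumes PQ: "(P, Q) \<in> coeff_pairs \<Gamma>" "P \<noteq> 0" and root: "poly P x = 0" "poly Q y = 0"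
    and min: "\<And>A B. (A, B) \<in> coeff_pairs \<Gamma> \<Longrightarrow> A \<noteq> 0 \<Longrightarrow> poly A x = 0 \<Longrightarrow> degree P \<le> degree A"
    and AB: "(A, B) \<in> coeff_pairs \<Gamma>" "poly A x = 0"
  shows "poly B y = 0"
  using AB
proof (induction "degree A" arbitrary: A B rule: less_induct)
  case less
  show ?case
  proof (cases "A = 0")
    case True
    hence "B = 0"
      using less.prems(1) partial_extension_zero
      by (intro poly_eqI) (auto simp: coeff_pairs_def)
    thus ?thesis by simp
  next
    case False
    define k where "k = degree A - degree P"
    have le: "degree P \<le> degree A" using min less.prems False by blast
    define A' where "A' = smult (lead_coeff P) A - monom (lead_coeff A) k * P"
    define B' where "B' = smult (lead_coeff Q) B - monom (lead_coeff B) k * Q"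
    have lc: "(lead_coeff S, lead_coeff T) \<in> \<Gamma>" if "(S, T) \<in> coeff_pairs \<Gamma>" for S T
      using that coeff_pairs_degree[OF that] by (auto simp: coeff_pairs_def)
    have A'B': "(A', B') \<in> coeff_pairs \<Gamma>"
    proof -
      have "([:lead_coeff P:] * A - monom (lead_coeff A) k * P,
             [:lead_coeff Q:] * B - monom (lead_coeff B) k * Q) \<in> coeff_pairs \<Gamma>"
        by (intro coeff_pairs_diff coeff_pairs_mult coeff_pairs_const coeff_pairs_monom lc PQ less.prems)
      thus ?thesis by (simp add: A'_def B'_def)
    qed
    have xA': "poly A' x = 0" using less.prems root by (simp add: A'_def poly_monom)
    have "poly B' y = 0"
    proof (cases "degree A' < degree A")
      case True
      thus ?thesis using less.hyps A'B' xA' by blast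
    next
      case F: False
      \<comment> \<open>The leading terms cancel, so the degree can fail to drop only if
        \<open>A'\<close> is zero.\<close>
      have "degree A' \<le> degree A"
        unfolding A'_def using le
        by (intro degree_diff_le order.trans[OF degree_mult_le])
           (auto simp: k_def intro: order.trans[OF add_mono[OF degree_monom_le order.refl]])
      moreover have "coeff A' (degree A) = 0"
        using le by (simp add: A'_def coeff_monom_mult k_def)
      ultimately have "A' = 0 \<or> degree A' < degree A"
        using F by (metis leading_coeff_0_iff le_neq_implies_less)
      with F have "A' = 0" by blast
      hence "B' = 0"
        using A'B' partial_extension_zero by (intro poly_eqI) (auto simp: coeff_pairs_def)
      thus ?thesis by simp
    qed
    hence "lead_coeff Q * poly B y = 0" using root by (simp add: B'_def poly_monom)
    moreover have "lead_coeff Q \<noteq> 0"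
      using lc[OF PQ(1)] partial_extension_inj PQ(2) by (metis leading_coeff_0_iff)
    ultimately show ?thesis by simp
  qed
qed

text \<open>The new graph is the image of evaluation at \<open>x\<close> and \<open>y\<close>; the
  hypothesis says exactly that this evaluation is well defined.\<close>

lemma partial_extension_adjoin:
  assumes y: "\<forall>(A, B)\<in>coeff_pairs \<Gamma>. poly A x = 0 \<longrightarrow> poly B y = 0"
  defines "\<Gamma>' \<equiv> (\<lambda>(A, B). (poly A x, poly B y)) ` coeff_pairs \<Gamma>"
  shows "partial_extension \<sigma> \<Gamma>'" "\<Gamma> \<subseteq> \<Gamma>'" "(x, y) \<in> \<Gamma>'"
proof -
  have I: "(poly A x, poly B y) \<in> \<Gamma>'" if "(A, B) \<in> coeff_pairs \<Gamma>" for A B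
    using that unfolding \<Gamma>'_def by force
  show sub: "\<Gamma> \<subseteq> \<Gamma>'"
    using I[OF coeff_pairs_const] by auto
  show "(x, y) \<in> \<Gamma>'" using I[OF coeff_pairs_X] by simp
  have E: "\<exists>A B. (A, B) \<in> coeff_pairs \<Gamma> \<and> a = poly A x \<and> b = poly B y" if "(a, b) \<in> \<Gamma>'" for a b
    using that unfolding \<Gamma>'_def by auto
  show "partial_extension \<sigma> \<Gamma>'"
    unfolding partial_extension_def
  proof (intro conjI allI ballI impI)
    show "(to_ac a, \<sigma> a) \<in> \<Gamma>'" for a using sub partial_extension_base by auto
    show "b = 0" if "(0, b) \<in> \<Gamma>'" for b using E[OF that] y by fastforce
    fix u assume u: "u \<in> \<Gamma>'"
    show "case u of (a, b) \<Rightarrow> \<forall>(c, d)\<in>\<Gamma>'. (a + c, b + d) \<in> \<Gamma>' \<and> (a * c, b * d) \<in> \<Gamma>'"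
    proof (clarify)
      fix a b c d assume "u = (a, b)" "(c, d) \<in> \<Gamma>'"
      with u E obtain A B C D where
        "(A, B) \<in> coeff_pairs \<Gamma>" "a = poly A x" "b = poly B y"
        "(C, D) \<in> coeff_pairs \<Gamma>" "c = poly C x" "d = poly D y" by metis
      with I[OF coeff_pairs_add[of A B C D]] I[OF coeff_pairs_mult[of A B C D]]
      show "(a + c, b + d) \<in> \<Gamma>' \<and> (a * c, b * d) \<in> \<Gamma>'" by simp
    qed
  qed
qed

end

lemma partial_extension_extend:
  fixes \<sigma> :: "'k :: field \<Rightarrow> 'c :: alg_closed_field"
  assumes \<sigma>: "field_hom \<sigma>" and \<Gamma>: "partial_extension \<sigma> \<Gamma>"
  obtains \<Gamma>' y where "partial_extension \<sigma> \<Gamma>'" "\<Gamma> \<subseteq> \<Gamma>'" "(x, y) \<in> \<Gamma>'"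
proof -
  define S where "S = {(P, Q). (P, Q) \<in> coeff_pairs \<Gamma> \<and> P \<noteq> 0 \<and> poly P x = 0}"
  obtain p :: "'k poly" where "p \<noteq> 0" "poly (map_poly to_ac p) x = 0"
    using alg_closure_algebraic by blast
  hence "(map_poly to_ac p, map_poly \<sigma> p) \<in> S"
    using coeff_pairs_map_poly[OF \<sigma> \<Gamma>, of p] by (simp add: S_def map_poly_eq_0_iff)
  \<comment> \<open>An equation of \<open>x\<close> over K shows that \<open>S\<close> is nonempty;
    an element of least degree serves as minimal polynomial.\<close>
  then obtain PQ where PQ: "PQ \<in> S" "\<And>z. z \<in> S \<Longrightarrow> degree (fst PQ) \<le> degree (fst z)"
    using ex_has_least_nat[of "\<lambda>z. z \<in> S" _ "\<lambda>z. degree (fst z)"] by metis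
  obtain P Q where [simp]: "PQ = (P, Q)" by force
  have P: "(P, Q) \<in> coeff_pairs \<Gamma>" "P \<noteq> 0" "poly P x = 0" using PQ(1) by (auto simp: S_def)
  have "degree P > 0"
    using P by (metis degree_eq_zeroE neq0_conv pCons_0_0 poly_const_conv)
  hence "degree Q > 0" using coeff_pairs_degree[OF \<sigma> \<Gamma> P(1)] by simp
  then obtain y where y: "poly Q y = 0" using alg_closed_imp_poly_has_root by blast
  have "\<forall>(A, B)\<in>coeff_pairs \<Gamma>. poly A x = 0 \<longrightarrow> poly B y = 0"
    using partial_extension_root[OF \<sigma> \<Gamma> P y] PQ(2) by (auto simp: S_def)
  from partial_extension_adjoin[OF \<sigma> \<Gamma> this] that show ?thesis by blast
qed

text \<open>A maximal partial extension exists by Zorn's lemma and is total, because any element of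
  K^s could otherwise be adjoined.\<close>

theorem alg_closure_extend_hom:
  fixes \<sigma> :: "'k :: field \<Rightarrow> 'c :: alg_closed_field"
  assumes \<sigma>: "field_hom \<sigma>"
  obtains \<tau> :: "'k alg_closure \<Rightarrow> 'c" where "field_hom \<tau>" "\<And>a. \<tau> (to_ac a) = \<sigma> a"
proof -
  interpret \<sigma>: field_hom \<sigma> by (rule \<sigma>)
  let ?\<A> = "Collect (partial_extension \<sigma>)"
  have "partial_extension \<sigma> (range (\<lambda>a. (to_ac a, \<sigma> a)))"
    by (force simp: partial_extension_def simp flip: to_ac_add to_ac_mult \<sigma>.hom_add \<sigma>.hom_mult)
  hence "?\<A> \<noteq> {}" by blast
  then obtain \<Gamma> where \<Gamma>: "partial_extension \<sigma> \<Gamma>"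
    and max: "\<And>\<Delta>. partial_extension \<sigma> \<Delta> \<Longrightarrow> \<Gamma> \<subseteq> \<Delta> \<Longrightarrow> \<Delta> = \<Gamma>"
  proof (rule subset_Zorn_nonempty[THEN bexE])
    fix C assume C: "C \<noteq> {}" "subset.chain ?\<A> C"
    then obtain \<Delta> where \<Delta>: "\<Delta> \<in> C" by blast
    have C': "partial_extension \<sigma> \<Delta>" if "\<Delta> \<in> C" for \<Delta>
      using C(2) that by (auto simp: subset.chain_def)
    have "(a + c, b + d) \<in> \<Union>C \<and> (a * c, b * d) \<in> \<Union>C" if ab: "(a, b) \<in> \<Union>C" "(c, d) \<in> \<Union>C" for a b c d
    proof -
      obtain \<Delta>1 \<Delta>2 where \<Delta>12: "\<Delta>1 \<in> C" "(a, b) \<in> \<Delta>1" "\<Delta>2 \<in> C" "(c, d) \<in> \<Delta>2"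
        using ab by blast
      moreover have "\<Delta>1 \<subseteq> \<Delta>2 \<or> \<Delta>2 \<subseteq> \<Delta>1"
        using C(2) \<Delta>12 unfolding subset_chain_def by blast
      ultimately obtain \<Delta> where \<Delta>: "\<Delta> \<in> C" "(a, b) \<in> \<Delta>" "(c, d) \<in> \<Delta>" by blast
      have "(a + c, b + d) \<in> \<Delta>" "(a * c, b * d) \<in> \<Delta>"
        using partial_extension_add[OF \<sigma> C'[OF \<Delta>(1)] \<Delta>(2,3)]
          partial_extension_mult[OF \<sigma> C'[OF \<Delta>(1)] \<Delta>(2,3)] by blast+
      with \<Delta>(1) show ?thesis by blast
    qed
    moreover have "(to_ac a, \<sigma> a) \<in> \<Union>C" for a
      using \<Delta> C' partial_extension_base[OF \<sigma>] by blast
    moreover have "b = 0" if "(0, b) \<in> \<Union>C" for b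
      using that C' partial_extension_zero[OF \<sigma>] by blast
    ultimately show "\<Union>C \<in> ?\<A>" unfolding partial_extension_def by blast
  qed auto
  have "\<exists>y. (x, y) \<in> \<Gamma>" for x
    using partial_extension_extend[OF \<sigma> \<Gamma>, of x] max by metis
  then obtain \<tau> where \<tau>: "\<And>x. (x, \<tau> x) \<in> \<Gamma>" by metis
  have eq: "\<tau> x = y" if "(x, y) \<in> \<Gamma>" for x y
    using partial_extension_single_valued[OF \<sigma> \<Gamma>] that \<tau> by blast
  have base: "\<tau> (to_ac a) = \<sigma> a" for a
    by (intro eq partial_extension_base[OF \<sigma> \<Gamma>])
  have "field_hom \<tau>"
  proof
    show "\<tau> (x + y) = \<tau> x + \<tau> y" "\<tau> (x * y) = \<tau> x * \<tau> y" for x y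
      by (intro eq partial_extension_add[OF \<sigma> \<Gamma>] partial_extension_mult[OF \<sigma> \<Gamma>] \<tau>)+
    show "\<tau> 0 = 0" "\<tau> 1 = 1" using base[of 0] base[of 1] by simp_all
  qed
  with base that show ?thesis by blast
qed

text \<open>The automorphism is conjugation transported along \<open>\<tau>\<close>. This is
  possible because the image of \<open>\<tau>\<close> is stable under \<open>cnj\<close>: an
  equation of \<open>x\<close> over K acquires real coefficients, so the conjugate of
  \<open>\<tau> x\<close> satisfies it too.\<close>

lemma obtain_complex_conjugation:
  fixes \<sigma> :: "'k :: field_char_0 \<Rightarrow> real"
  assumes \<sigma>: "field_hom \<sigma>"
  obtains \<tau> :: "'k alg_closure \<Rightarrow> complex" and \<gamma>
  where "field_hom \<tau>" "\<gamma> \<in> Gal" "\<And>x. \<tau> (\<gamma> x) = cnj (\<tau> x)"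
proof -
  interpret \<sigma>: field_hom \<sigma> by (rule \<sigma>)
  interpret c\<sigma>: field_hom "\<lambda>a. complex_of_real (\<sigma> a)"
    by unfold_locales (auto simp: \<sigma>.hom_add \<sigma>.hom_mult)
  obtain \<tau> :: "'k alg_closure \<Rightarrow> complex"
    where \<tau>: "field_hom \<tau>" "\<And>a. \<tau> (to_ac a) = complex_of_real (\<sigma> a)"
    using alg_closure_extend_hom[OF c\<sigma>.field_hom_axioms] by blast
  interpret \<tau>: field_hom \<tau> by (rule \<tau>(1))
  interpret M: map_poly_comm_ring_hom \<tau> ..
  have "\<exists>y. \<tau> y = cnj (\<tau> x)" for x
  proof -
    obtain p :: "'k poly" where p: "p \<noteq> 0" "poly (map_poly to_ac p) x = 0"
      using alg_closure_algebraic by blast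
    define P where "P = map_poly to_ac p"
    have P: "P \<noteq> 0" "poly P x = 0" using p by (auto simp: P_def map_poly_eq_0_iff)
    have PC: "map_poly \<tau> P = map_poly complex_of_real (map_poly \<sigma> p)"
      by (simp add: P_def map_poly_map_poly o_def \<tau>(2))
    have "poly (map_poly \<tau> P) (\<tau> x) = 0" using P by (simp add: \<tau>.poly_map_poly)
    hence root: "poly (map_poly \<tau> P) (cnj (\<tau> x)) = 0"
      using poly_cnj_real[of "map_poly \<tau> P" "\<tau> x"] by (simp add: PC coeff_map_poly)
    \<comment> \<open>\<open>P\<close> splits over K^s, so every complex root of its image is the
      image of a root in K^s.\<close>
    obtain A where A: "size A = degree P" "P = smult (lead_coeff P) (\<Prod>z\<in>#A. [:-z, 1:])"
      using alg_closed_imp_factorization[OF P(1)] by metis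
    have "poly (map_poly \<tau> P) w = \<tau> (lead_coeff P) * (\<Prod>z\<in>#A. (w - \<tau> z))" for w
    proof -
      have "map_poly \<tau> (\<Prod>z\<in>#A. [:-z, 1:]) = (\<Prod>z\<in>#A. [:-\<tau> z, 1:])" for A
        by (induction A) (auto simp: M.hom_mult \<tau>.hom_uminus simp del: mult_pCons_left)
      thus ?thesis
        by (subst A(2)) (simp add: hom_distribs poly_prod_mset image_mset.compositionality o_def)
    qed
    with root P obtain z where "z \<in># A" "cnj (\<tau> x) - \<tau> z = 0" by auto
    thus ?thesis by (intro exI[of _ z]) simp
  qed
  then obtain \<gamma> where \<gamma>: "\<And>x. \<tau> (\<gamma> x) = cnj (\<tau> x)" by metis
  have inj: "\<tau> x = \<tau> y \<Longrightarrow> x = y" for x y by simp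
  have "\<gamma> (\<gamma> x) = x" for x by (rule inj) (simp add: \<gamma>)
  hence "bij \<gamma>" by (intro o_bij[of \<gamma>]) auto
  moreover have "field_hom \<gamma>"
    by unfold_locales (rule inj, simp add: \<gamma> hom_distribs)+
  moreover have "\<gamma> (to_ac a) = to_ac a" for a by (rule inj) (simp add: \<gamma> \<tau>(2))
  ultimately have "\<gamma> \<in> Gal" by (simp add: Gal_def)
  with \<gamma> \<tau>(1) that show ?thesis by blast
qed

section \<open>Connectedness of orthogonal centralizers\<close>

lemma carrier_GL: "carrier (GL n) = {A \<in> carrier_mat n n. det A \<noteq> (0 :: 'a :: field)}"
proof -
  have "A \<in> Units (ring_mat TYPE('a) n ()) \<longleftrightarrow> A \<in> carrier_mat n n \<and> det A \<noteq> 0" for A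
    using unit_imp_det_non_zero[of A n "()"] det_non_zero_imp_unit[of A n "()"]
    by (auto simp: Units_def ring_mat_simps)
  thus ?thesis unfolding GL_def units_of_carrier by blast
qed

lemma GL_simps [simp]: "A \<otimes>\<^bsub>GL n\<^esub> B = A * B" "\<one>\<^bsub>GL n\<^esub> = 1\<^sub>m n"
  by (simp_all add: GL_def units_of_mult units_of_one ring_mat_simps)

lemma group_GL: "group (GL n :: 'a :: field mat monoid)"
  unfolding GL_def by (intro monoid.units_group ring.is_monoid ring_mat)

lemma topspace_zariski:
  assumes "1 \<in> C" shows "topspace (zariski C n) = carrier (GL n)"
proof -
  have "carrier (GL n) = {A \<in> carrier (GL n). (\<lambda>_. 1) A \<noteq> (0 :: 'a)}" by simp
  with regular.const[OF assms, of n] show ?thesis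
    unfolding zariski_def topology_generated_by_topspace by blast
qed

lemma closedin_zariski_zeros:
  assumes "1 \<in> C" "F \<subseteq> regular C n"
  shows "closedin (zariski C n) {A \<in> carrier (GL n). \<forall>f\<in>F. f A = 0}"
proof -
  have "carrier (GL n) - {A \<in> carrier (GL n). \<forall>f\<in>F. f A = 0} =
      (\<Union>f\<in>F. {A \<in> carrier (GL n). f A \<noteq> 0})" by auto
  moreover have "openin (zariski C n) (\<Union>f\<in>F. {A \<in> carrier (GL n). f A \<noteq> 0})"
    using assms(2) unfolding zariski_def
    by (intro openin_Union) (auto intro!: topology_generated_by_Basis)
  ultimately show ?thesis
    by (simp add: closedin_def topspace_zariski[OF assms(1)])
qed

text \<open>The generating sets form a base and not just a subbase: the product of two functions
  cuts out the intersection of their nonvanishing loci.\<close>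

lemma openin_zariski_basic:
  assumes "openin (zariski C n) E" "A \<in> E"
  obtains f where "f \<in> regular C n" "f A \<noteq> 0" "\<And>B. B \<in> carrier (GL n) \<Longrightarrow> f B \<noteq> 0 \<Longrightarrow> B \<in> E"
proof -
  have "generate_topology_on {{A \<in> carrier (GL n). f A \<noteq> 0} |f. f \<in> regular C n} E"
    using assms(1) unfolding zariski_def by (rule openin_topology_generated_by)
  hence "\<forall>A\<in>E. \<exists>f\<in>regular C n. f A \<noteq> 0 \<and> (\<forall>B\<in>carrier (GL n). f B \<noteq> 0 \<longrightarrow> B \<in> E)"
  proof induction
    case (Int E1 E2)
    show ?case
    proof
      fix A assume "A \<in> E1 \<inter> E2"
      with Int.IH obtain f g where "f \<in> regular C n" "g \<in> regular C n" "f A \<noteq> 0" "g A \<noteq> 0"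
        "\<forall>B\<in>carrier (GL n). f B \<noteq> 0 \<longrightarrow> B \<in> E1" "\<forall>B\<in>carrier (GL n). g B \<noteq> 0 \<longrightarrow> B \<in> E2"
        by (metis IntD1 IntD2)
      thus "\<exists>f\<in>regular C n. f A \<noteq> 0 \<and> (\<forall>B\<in>carrier (GL n). f B \<noteq> 0 \<longrightarrow> B \<in> E1 \<inter> E2)"
        by (intro bexI[of _ "\<lambda>A. f A * g A"] regular.mult) auto
    qed
  next
    case (UN K)
    show ?case
    proof
      fix A assume "A \<in> \<Union>K"
      then obtain E where E: "E \<in> K" "A \<in> E" by blast
      with UN.IH[OF E(1)] obtain f where "f \<in> regular C n" "f A \<noteq> 0"
        "\<forall>B\<in>carrier (GL n). f B \<noteq> 0 \<longrightarrow> B \<in> E" by blast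
      with E(1) show "\<exists>f\<in>regular C n. f A \<noteq> 0 \<and> (\<forall>B\<in>carrier (GL n). f B \<noteq> 0 \<longrightarrow> B \<in> \<Union>K)"
        by blast
    qed
  qed auto
  with assms(2) that show ?thesis by metis
qed

text \<open>These are the regular functions on the affine line without the zeros of
  \<open>q\<close>, the localization of the polynomial ring at \<open>q\<close>. Values at the zeros
  are left free, so total functions of \<open>t\<close> can be used throughout.\<close>

definition rational_on :: "'a :: field poly \<Rightarrow> ('a \<Rightarrow> 'a) set"
  where "rational_on q = {F. \<exists>p k. \<forall>t. poly q t \<noteq> 0 \<longrightarrow> F t = poly p t / poly q t ^ k}"

lemma rational_onI: "(\<And>t. poly q t \<noteq> 0 \<Longrightarrow> F t = poly p t / poly q t ^ k) \<Longrightarrow> F \<in> rational_on q"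
  unfolding rational_on_def by blast

lemma rational_on_poly: "(\<lambda>t. poly p t) \<in> rational_on q"
  by (rule rational_onI[where k = 0]) simp

lemma rational_on_const: "(\<lambda>_. a) \<in> rational_on q"
  using rational_on_poly[of "[:a:]"] by simp

lemma rational_on_inverse: "(\<lambda>t. inverse (poly q t)) \<in> rational_on q"
  by (rule rational_onI[where k = 1 and p = 1]) (simp add: divide_inverse)

lemma rational_on_add:
  assumes "F \<in> rational_on q" "G \<in> rational_on q"
  shows "(\<lambda>t. F t + G t) \<in> rational_on q"
proof -
  obtain p k r l where "\<And>t. poly q t \<noteq> 0 \<Longrightarrow> F t = poly p t / poly q t ^ k"
    "\<And>t. poly q t \<noteq> 0 \<Longrightarrow> G t = poly r t / poly q t ^ l"
    using assms unfolding rational_on_def by blast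
  thus ?thesis
    by (intro rational_onI[where p = "p * q ^ l + r * q ^ k" and k = "k + l"])
      (simp add: power_add add_frac_eq)
qed

lemma rational_on_mult:
  assumes "F \<in> rational_on q" "G \<in> rational_on q"
  shows "(\<lambda>t. F t * G t) \<in> rational_on q"
proof -
  obtain p k r l where "\<And>t. poly q t \<noteq> 0 \<Longrightarrow> F t = poly p t / poly q t ^ k"
    "\<And>t. poly q t \<noteq> 0 \<Longrightarrow> G t = poly r t / poly q t ^ l"
    using assms unfolding rational_on_def by blast
  thus ?thesis
    by (intro rational_onI[where p = "p * r" and k = "k + l"]) (simp add: power_add)
qed

lemma rational_on_sum:
  "(\<And>i. i \<in> I \<Longrightarrow> F i \<in> rational_on q) \<Longrightarrow> (\<lambda>t. \<Sum>i\<in>I. F i t) \<in> rational_on q"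
  by (induction I rule: infinite_finite_induct) (auto intro: rational_on_const rational_on_add)

lemma rational_on_prod:
  "(\<And>i. i \<in> I \<Longrightarrow> F i \<in> rational_on q) \<Longrightarrow> (\<lambda>t. \<Prod>i\<in>I. F i t) \<in> rational_on q"
  by (induction I rule: infinite_finite_induct) (auto intro: rational_on_const rational_on_mult)

lemma rational_on_det:
  assumes "\<And>t. h t \<in> carrier_mat n n"
    and "\<And>i j. i < n \<Longrightarrow> j < n \<Longrightarrow> (\<lambda>t. h t $$ (i, j)) \<in> rational_on q"
  shows "(\<lambda>t. det (h t)) \<in> rational_on q"
  unfolding det_def'[OF assms(1)]
  by (intro rational_on_sum rational_on_mult rational_on_const rational_on_prod assms(2))
    (auto simp: permutes_in_image)

lemma rational_on_regular:
  assumes "f \<in> regular UNIV n"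
    and "\<And>i j. i < n \<Longrightarrow> j < n \<Longrightarrow> (\<lambda>t. h t $$ (i, j)) \<in> rational_on q"
    and "(\<lambda>t. inverse (det (h t))) \<in> rational_on q"
  shows "(\<lambda>t. f (h t)) \<in> rational_on q"
  using assms(1)
  by induction (auto intro: assms rational_on_const rational_on_add rational_on_mult)

text \<open>Nonvanishing of a rational function excludes only finitely many parameters, so any two
  nonempty open subsets of the curve meet.\<close>

lemma connectedin_rational_curve:
  fixes h :: "'a :: field_char_0 \<Rightarrow> 'a mat"
  assumes "q \<noteq> 0" and h: "\<And>t. poly q t \<noteq> 0 \<Longrightarrow> h t \<in> carrier (GL n)"
    and reg: "\<And>i j. i < n \<Longrightarrow> j < n \<Longrightarrow> (\<lambda>t. h t $$ (i, j)) \<in> rational_on q"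
      "(\<lambda>t. inverse (det (h t))) \<in> rational_on q"
  shows "connectedin (zariski UNIV n) (h ` {t. poly q t \<noteq> 0})" (is "connectedin _ ?S")
proof -
  have False if E: "openin (zariski UNIV n) E1" "openin (zariski UNIV n) E2"
      "E1 \<inter> E2 \<inter> ?S = {}" "E1 \<inter> ?S \<noteq> {}" "E2 \<inter> ?S \<noteq> {}" for E1 E2
  proof -
    have P: "\<exists>p. p \<noteq> 0 \<and> (\<forall>t. poly q t \<noteq> 0 \<and> poly p t \<noteq> 0 \<longrightarrow> h t \<in> E)"
      if openE: "openin (zariski UNIV n) E" and ne: "E \<inter> ?S \<noteq> {}" for E
    proof -
      obtain s where s: "h s \<in> E" "poly q s \<noteq> 0" using ne by auto
      obtain f where f: "f \<in> regular UNIV n" "f (h s) \<noteq> 0"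
          "\<And>B. B \<in> carrier (GL n) \<Longrightarrow> f B \<noteq> 0 \<Longrightarrow> B \<in> E"
        using openin_zariski_basic[OF openE s(1)] by metis
      obtain p k where pk: "\<And>t. poly q t \<noteq> 0 \<Longrightarrow> f (h t) = poly p t / poly q t ^ k"
        using rational_on_regular[OF f(1) reg] unfolding rational_on_def by blast
      have "p \<noteq> 0" using f(2) pk[OF s(2)] by auto
      with f(3) pk h show ?thesis by (intro exI[of _ p]) auto
    qed
    obtain p1 p2 where p: "p1 \<noteq> 0" "p2 \<noteq> 0"
      "\<And>t. poly q t \<noteq> 0 \<Longrightarrow> poly p1 t \<noteq> 0 \<Longrightarrow> h t \<in> E1"
      "\<And>t. poly q t \<noteq> 0 \<Longrightarrow> poly p2 t \<noteq> 0 \<Longrightarrow> h t \<in> E2"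
      using P[of E1] P[of E2] E by metis
    have "finite {t. poly (q * p1 * p2) t = 0}"
      using p \<open>q \<noteq> 0\<close> by (intro poly_roots_finite) auto
    then obtain t where "poly (q * p1 * p2) t \<noteq> 0"
      using ex_new_if_finite[OF infinite_UNIV_char_0] by blast
    with p E(3) show False by auto
  qed
  moreover have "?S \<subseteq> topspace (zariski UNIV n)"
    using h by (auto simp: topspace_zariski)
  ultimately show ?thesis unfolding connectedin by metis
qed

lemma connectedin_of_curves:
  assumes "a \<in> topspace \<T>"
    and "\<And>x. x \<in> G \<Longrightarrow> \<exists>S. connectedin \<T> S \<and> a \<in> S \<and> x \<in> S \<and> S \<subseteq> G"
  shows "connectedin \<T> G"
proof -
  obtain S where S: "\<And>x. x \<in> G \<Longrightarrow> connectedin \<T> (S x) \<and> a \<in> S x \<and> x \<in> S x \<and> S x \<subseteq> G"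
    using assms(2) by metis
  have "connectedin \<T> (\<Union>(S ` G))" if "G \<noteq> {}"
    using S that by (intro connectedin_Union) auto
  moreover have "\<Union>(S ` G) = G" using S by blast
  ultimately show ?thesis by (cases "G = {}") auto
qed

section \<open>Groups of orthogonal matrices with prescribed commuting matrices\<close>

definition orthogonal_centralizer :: "nat \<Rightarrow> 'a :: comm_ring_1 mat set \<Rightarrow> 'a mat set"
  where "orthogonal_centralizer n Z =
    {A \<in> carrier_mat n n. transpose_mat A * A = 1\<^sub>m n \<and> (\<forall>z\<in>Z. A * z = z * A)}"

lemma commutes_mult:
  assumes "A \<in> carrier_mat n n" "B \<in> carrier_mat n n" "Z \<in> carrier_mat n n"
    and "A * Z = Z * A" "B * Z = Z * B"
  shows "(A * B) * Z = Z * (A * B :: 'a :: comm_ring_1 mat)"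
proof -
  have "(A * B) * Z = A * (B * Z)" using assms by (intro assoc_mult_mat) auto
  also have "B * Z = Z * B" by fact
  also have "A * (Z * B) = A * Z * B" using assms by (intro assoc_mult_mat[symmetric]) auto
  also have "A * Z = Z * A" by fact
  also have "Z * A * B = Z * (A * B)" using assms by (intro assoc_mult_mat) auto
  finally show ?thesis .
qed

lemma commutes_add:
  assumes "A \<in> carrier_mat n n" "B \<in> carrier_mat n n" "Z \<in> carrier_mat n n"
    and "A * Z = Z * A" "B * Z = Z * B"
  shows "(A + B) * Z = Z * (A + B :: 'a :: comm_ring_1 mat)"
  using assms by (simp add: add_mult_distrib_mat[of A n n B Z n] mult_add_distrib_mat[of Z n n A n B])

lemma commutes_smult:
  assumes "A \<in> carrier_mat n n" "Z \<in> carrier_mat n n" "A * Z = Z * A"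
  shows "(c \<cdot>\<^sub>m A) * Z = Z * (c \<cdot>\<^sub>m A :: 'a :: comm_ring_1 mat)"
  using assms by (simp add: mult_smult_distrib[of Z n n A n] mult_smult_assoc_mat[of A n n Z n])

lemma commutes_inverse:
  assumes "A \<in> carrier_mat n n" "B \<in> carrier_mat n n" "Z \<in> carrier_mat n n"
    and "A * B = 1\<^sub>m n" "B * A = 1\<^sub>m n" "A * Z = Z * A"
  shows "B * Z = Z * (B :: 'a :: comm_ring_1 mat)"
proof -
  have "B * Z = B * Z * (A * B)" using assms by simp
  also have "\<dots> = B * (Z * (A * B))" using assms by (intro assoc_mult_mat) auto
  also have "Z * (A * B) = Z * A * B" using assms by (intro assoc_mult_mat[symmetric]) auto
  also have "Z * A = A * Z" using assms by simp
  also have "A * Z * B = A * (Z * B)" using assms by (intro assoc_mult_mat) auto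
  also have "B * \<dots> = B * A * (Z * B)" using assms by (intro assoc_mult_mat[symmetric]) auto
  finally show ?thesis using assms by simp
qed

context
  fixes n :: nat and Z :: "'a :: field mat set"
  assumes Z: "Z \<subseteq> carrier_mat n n"
begin

lemma orthogonal_centralizer_right_inverse:
  "A \<in> orthogonal_centralizer n Z \<Longrightarrow> A * transpose_mat A = 1\<^sub>m n"
  by (rule mat_mult_left_right_inverse[of _ n]) (auto simp: orthogonal_centralizer_def)

lemma orthogonal_centralizer_det:
  assumes "A \<in> orthogonal_centralizer n Z"
  shows "det A * det A = 1"
proof -
  have A: "A \<in> carrier_mat n n" "transpose_mat A * A = 1\<^sub>m n"
    using assms by (auto simp: orthogonal_centralizer_def)
  thus ?thesis using det_mult[of "transpose_mat A" n A] by (simp add: det_transpose)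
qed

lemma orthogonal_centralizer_GL: "orthogonal_centralizer n Z \<subseteq> carrier (GL n)"
proof
  fix A assume A: "A \<in> orthogonal_centralizer n Z"
  have "det A \<noteq> 0" using orthogonal_centralizer_det[OF A] by auto
  with A show "A \<in> carrier (GL n)" by (simp add: carrier_GL orthogonal_centralizer_def)
qed

lemma one_in_orthogonal_centralizer: "1\<^sub>m n \<in> orthogonal_centralizer n Z"
  using Z by (auto simp: orthogonal_centralizer_def subset_iff)

lemma orthogonal_centralizer_mult:
  assumes "A \<in> orthogonal_centralizer n Z" "B \<in> orthogonal_centralizer n Z"
  shows "A * B \<in> orthogonal_centralizer n Z"
proof -
  have A: "A \<in> carrier_mat n n" "transpose_mat A * A = 1\<^sub>m n" and
    B: "B \<in> carrier_mat n n" "transpose_mat B * B = 1\<^sub>m n"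
    using assms by (auto simp: orthogonal_centralizer_def)
  have "transpose_mat (A * B) * (A * B) = transpose_mat B * (transpose_mat A * (A * B))"
    using A B by (simp add: transpose_mult[of A n n B n] assoc_mult_mat[of _ n n _ n _ n])
  also have "transpose_mat A * (A * B) = (transpose_mat A * A) * B"
    using A B by (intro assoc_mult_mat[symmetric]) auto
  finally have "transpose_mat (A * B) * (A * B) = 1\<^sub>m n" using A B by simp
  moreover have "(A * B) * z = z * (A * B)" if "z \<in> Z" for z
    using assms that Z by (intro commutes_mult) (auto simp: orthogonal_centralizer_def)
  ultimately show ?thesis using A B by (simp add: orthogonal_centralizer_def)
qed

lemma orthogonal_centralizer_transpose:
  assumes "A \<in> orthogonal_centralizer n Z"
  shows "transpose_mat A \<in> orthogonal_centralizer n Z"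
  using assms orthogonal_centralizer_right_inverse[OF assms] Z
  by (auto simp: orthogonal_centralizer_def intro!: commutes_inverse[of A n "transpose_mat A"])

lemma inv_GL_orthogonal_centralizer:
  assumes "A \<in> orthogonal_centralizer n Z"
  shows "inv\<^bsub>GL n\<^esub> A = transpose_mat A"
  using assms orthogonal_centralizer_GL orthogonal_centralizer_transpose[OF assms]
  by (intro group.inv_equality[OF group_GL]) (auto simp: orthogonal_centralizer_def)

lemma subgroup_orthogonal_centralizer: "subgroup (orthogonal_centralizer n Z) (GL n)"
proof
  fix A B assume AB: "A \<in> orthogonal_centralizer n Z" "B \<in> orthogonal_centralizer n Z"
  thus "A \<otimes>\<^bsub>GL n\<^esub> B \<in> orthogonal_centralizer n Z"
    by (simp add: orthogonal_centralizer_mult)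
  show "inv\<^bsub>GL n\<^esub> A \<in> orthogonal_centralizer n Z"
    using AB(1) by (simp only: inv_GL_orthogonal_centralizer orthogonal_centralizer_transpose)
qed (use orthogonal_centralizer_GL one_in_orthogonal_centralizer in auto)

lemma regular_sum:
  assumes "0 \<in> C" "\<And>i. i \<in> I \<Longrightarrow> F i \<in> regular C n"
  shows "(\<lambda>A. \<Sum>i\<in>I. F i A) \<in> regular C n"
  using assms(2) by (induction I rule: infinite_finite_induct)
    (auto intro: regular.const[OF assms(1)] regular.add)

lemma closedin_orthogonal_centralizer:
  assumes C: "0 \<in> C" "1 \<in> C" "-1 \<in> C"
    and entries: "\<And>z i j. z \<in> Z \<Longrightarrow> i < n \<Longrightarrow> j < n \<Longrightarrow> z $$ (i, j) \<in> C"
  shows "closedin (zariski C n) (orthogonal_centralizer n Z)"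
proof -
  \<comment> \<open>\<open>f\<close> and \<open>g\<close> are the entries of
    \<open>transpose_mat A * A - 1\<^sub>m n\<close> and of \<open>A * z - z * A\<close>. Signs
    enter as constants because \<open>regular\<close> is generated by sums and products.\<close>
  define f where "f = (\<lambda>(i, j) A. (\<Sum>k<n. A $$ (k, i) * A $$ (k, j)) + (if i = j then -1 else 0 :: 'a))"
  define g where "g = (\<lambda>(z, i, j) A. (\<Sum>k<n. A $$ (i, k) * z $$ (k, j)) +
      (-1) * (\<Sum>k<n. z $$ (i, k) * A $$ (k, j)) :: 'a)"
  define F where "F = f ` ({..<n} \<times> {..<n}) \<union> g ` (Z \<times> {..<n} \<times> {..<n})"
  have "f (i, j) \<in> regular C n" if "i < n" "j < n" for i j
    unfolding f_def split using that C
    by (intro regular.add regular_sum regular.mult regular.entry regular.const) auto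
  moreover have "g (z, i, j) \<in> regular C n" if "z \<in> Z" "i < n" "j < n" for z i j
    unfolding g_def split using that C entries
    by (intro regular.add regular_sum regular.mult regular.entry regular.const) auto
  ultimately have "F \<subseteq> regular C n" unfolding F_def by auto
  hence "closedin (zariski C n) {A \<in> carrier (GL n). \<forall>f\<in>F. f A = 0}"
    by (intro closedin_zariski_zeros C)
  also have "{A \<in> carrier (GL n). \<forall>f\<in>F. f A = 0} = orthogonal_centralizer n Z"
  proof -
    have 1: "transpose_mat A * A = 1\<^sub>m n \<longleftrightarrow> (\<forall>i<n. \<forall>j<n. f (i, j) A = 0)"
      if "A \<in> carrier_mat n n" for A
      using that by (auto simp: mat_eq_iff f_def scalar_prod_def lessThan_atLeast0
          eq_neg_iff_add_eq_0 [symmetric] split: if_splits)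
    have 2: "A * z = z * A \<longleftrightarrow> (\<forall>i<n. \<forall>j<n. g (z, i, j) A = 0)"
      if "A \<in> carrier_mat n n" "z \<in> carrier_mat n n" for A z
      using that by (auto simp: mat_eq_iff g_def scalar_prod_def lessThan_atLeast0)
    have "A \<in> orthogonal_centralizer n Z \<longleftrightarrow> A \<in> carrier (GL n) \<and> (\<forall>f\<in>F. f A = 0)" for A
    proof (cases "A \<in> carrier (GL n)")
      case True
      hence "A \<in> carrier_mat n n" by (simp add: carrier_GL)
      with True 1[OF this] 2[OF this] Z show ?thesis
        unfolding F_def orthogonal_centralizer_def by (fastforce simp: subset_iff)
    next
      case False
      thus ?thesis using orthogonal_centralizer_GL by blast
    qed
    thus ?thesis by blast
  qed
  finally show ?thesis .
qed

lemma alg_group_orthogonal_centralizer: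
  assumes "0 \<in> C" "1 \<in> C" "-1 \<in> C" "\<And>z i j. z \<in> Z \<Longrightarrow> i < n \<Longrightarrow> j < n \<Longrightarrow> z $$ (i, j) \<in> C"
  shows "alg_group C n (orthogonal_centralizer n Z)"
  using closedin_orthogonal_centralizer[OF assms] subgroup_orthogonal_centralizer
  by (simp add: alg_group_def)

end

lemma transpose_smult_mat: "transpose_mat (c \<cdot>\<^sub>m A) = c \<cdot>\<^sub>m transpose_mat A"
  by (rule eq_matI) auto

lemma smult_smult_mat: "a \<cdot>\<^sub>m (b \<cdot>\<^sub>m A) = (a * b) \<cdot>\<^sub>m (A :: 'a :: semigroup_mult mat)"
  by (rule eq_matI) (auto simp: mult.assoc)

text \<open>The projections onto the eigenspaces of \<open>J\<close> for \<open>-i\<close> and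
  \<open>i\<close> are (1 + iJ)/2 and (1 - iJ)/2. Transposition changes the sign of \<open>J\<close>
  and so exchanges them, which makes both eigenspaces isotropic.\<close>

lemma idempotent_square_minus_one:
  fixes J :: "'a :: field_char_0 mat" and i :: 'a
  assumes J: "J \<in> carrier_mat n n" "J * J = -1\<^sub>m n" "transpose_mat J = -J" and i: "i * i = -1"
  obtains e e' where "e \<in> carrier_mat n n" "e' \<in> carrier_mat n n" "e + e' = 1\<^sub>m n"
    "e * e = e" "e' * e' = e'" "e * e' = 0\<^sub>m n n" "e' * e = 0\<^sub>m n n"
    "transpose_mat e = e'" "transpose_mat e' = e"
    "\<And>A. A \<in> carrier_mat n n \<Longrightarrow> A * J = J * A \<Longrightarrow> A * e = e * A \<and> A * e' = e' * A"
proof -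
  define E where "E = (\<lambda>s. (1/2) \<cdot>\<^sub>m (1\<^sub>m n + (s * i) \<cdot>\<^sub>m J))"
  have E: "E s \<in> carrier_mat n n" for s using J by (simp add: E_def)
  have comm: "A * E s = E s * A" if A: "A \<in> carrier_mat n n" "A * J = J * A" for A s
  proof -
    have "(1\<^sub>m n + (s * i) \<cdot>\<^sub>m J) * A = A * (1\<^sub>m n + (s * i) \<cdot>\<^sub>m J)"
      by (intro commutes_add commutes_smult) (use A J in auto)
    thus ?thesis unfolding E_def
      by (intro commutes_smult[symmetric]) (use A J in auto)
  qed
  have prod: "E s * E t = (1/4) \<cdot>\<^sub>m ((1 + s * t) \<cdot>\<^sub>m 1\<^sub>m n + ((s + t) * i) \<cdot>\<^sub>m J)" for s t
  proof -
    let ?P = "\<lambda>s. 1\<^sub>m n + (s * i) \<cdot>\<^sub>m J"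
    have "?P s * ?P t = ?P t + ((s * i) \<cdot>\<^sub>m J) * ?P t"
      using J by (simp add: add_mult_distrib_mat[of "1\<^sub>m n" n n _ _ n])
    also have "((s * i) \<cdot>\<^sub>m J) * ?P t = (s * i) \<cdot>\<^sub>m J + (s * i) \<cdot>\<^sub>m ((t * i) \<cdot>\<^sub>m (J * J))"
      using J by (simp add: mult_add_distrib_mat[of _ n n _ n] mult_smult_distrib[of J n n _ n]
          mult_smult_assoc_mat[of J n n _ n] )
    also have "?P t + \<dots> = (1 + s * t) \<cdot>\<^sub>m 1\<^sub>m n + ((s + t) * i) \<cdot>\<^sub>m J"
    proof -
      have "s * i * (t * i) = - (s * t)" using i by (metis mult.commute mult.left_commute mult_minus1_right)
      thus ?thesis unfolding J(2) using J(1)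
        by (intro eq_matI) (auto simp: algebra_simps)
    qed
    finally show ?thesis using J
      by (simp add: E_def mult_smult_distrib[of _ n n _ n] mult_smult_assoc_mat[of _ n n _ n] smult_smult_mat)
  qed
  have tr: "transpose_mat (E s) = E (- s)" for s
  proof -
    have "J $$ (k, l) = - J $$ (l, k)" if "k < n" "l < n" for k l
      using arg_cong[OF J(3), of "\<lambda>M. M $$ (l, k)"] that J(1) by simp
    note skew = this
    show ?thesis
    proof (rule eq_matI)
      fix k l assume "k < dim_row (E (- s))" "l < dim_col (E (- s))"
      hence kl: "k < n" "l < n" using E[of "-s"] by auto
      with J(1) show "transpose_mat (E s) $$ (k, l) = E (- s) $$ (k, l)"
        by (simp add: E_def skew[OF kl(2,1)])
    qed (use E[of s] E[of "-s"] in auto)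
  qed
  show ?thesis
  proof (rule that[of "E 1" "E (-1)"])
    show "E 1 + E (-1) = 1\<^sub>m n" using J by (intro eq_matI) (auto simp: E_def field_simps)
    show "E 1 * E 1 = E 1" "E (-1) * E (-1) = E (-1)"
      "E 1 * E (-1) = 0\<^sub>m n n" "E (-1) * E 1 = 0\<^sub>m n n"
      unfolding prod using J by (intro eq_matI; auto simp: E_def field_simps)+
  qed (use E tr comm in auto)
qed

text \<open>\<open>J\<close> splits the space into two isotropic eigenspaces in duality, with projections \<open>e\<close> and
  \<open>e'\<close>, and the group acts by \<open>B\<close> on the first and by the contragredient of \<open>B\<close> on the second.
  The line from 1 to \<open>A\<close> in the linear space of all \<open>B\<close> yields a curve in the group.\<close>

lemma connectedin_orthogonal_centralizer:
  fixes Z :: "'a :: field_char_0 mat set" and i :: 'a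
  assumes Z: "Z \<subseteq> carrier_mat n n" and J: "J \<in> Z" "J * J = -1\<^sub>m n" "transpose_mat J = -J"
    and i: "i * i = -1"
    and Z_J: "\<And>z. z \<in> Z \<Longrightarrow> z * J = J * z"
    and Z_transpose: "\<And>z. z \<in> Z \<Longrightarrow> transpose_mat z = z \<or> transpose_mat z = -z"
  shows "connectedin (zariski UNIV n) (orthogonal_centralizer n Z)"
proof (rule connectedin_of_curves)
  have one_carrier: "1\<^sub>m n \<in> carrier (GL n)" by (simp add: carrier_GL)
  thus "1\<^sub>m n \<in> topspace (zariski UNIV n)" by (simp add: topspace_zariski)
  have Jc: "J \<in> carrier_mat n n" using J Z by auto
  obtain e e' where e: "e \<in> carrier_mat n n" "e' \<in> carrier_mat n n" "e + e' = 1\<^sub>m n"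
    "e * e = e" "e' * e' = e'" "e * e' = 0\<^sub>m n n" "e' * e = 0\<^sub>m n n"
    "transpose_mat e = e'" "transpose_mat e' = e"
    and comm_e: "\<And>A. A \<in> carrier_mat n n \<Longrightarrow> A * J = J * A \<Longrightarrow> A * e = e * A \<and> A * e' = e' * A"
    using idempotent_square_minus_one[OF Jc J(2,3) i] by metis
  \<comment> \<open>\<open>Z\<close> is stable under transposition up to sign, so its commutant is
    stable under transposition; this is what makes the contragredient \<open>D\<close> commute with
    \<open>Z\<close>.\<close>
  have tc: "transpose_mat M * z = z * transpose_mat M"
    if Mz: "M \<in> carrier_mat n n" "M * z = z * M" "z \<in> Z" for M z
  proof -
    have z: "z \<in> carrier_mat n n" using Z Mz by auto
    have "transpose_mat z * transpose_mat M = transpose_mat M * transpose_mat z"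
      using arg_cong[OF Mz(2), of transpose_mat] Mz(1) z by (simp add: transpose_mult)
    with Z_transpose[OF Mz(3)] Mz(1) z show ?thesis
      by (auto simp: uminus_mult_left_mat uminus_mult_right_mat)
  qed
  have key: "B * e + D * e' \<in> orthogonal_centralizer n Z"
    if B: "B \<in> carrier_mat n n" "\<And>z. z \<in> Z \<Longrightarrow> B * z = z * B"
      and D: "D \<in> carrier_mat n n" "transpose_mat B * D = 1\<^sub>m n" for B D
  proof -
    let ?B = "transpose_mat B" and ?D = "transpose_mat D"
    have Bt: "?B \<in> carrier_mat n n" "?D \<in> carrier_mat n n" using B D by auto
    have DB': "D * ?B = 1\<^sub>m n" by (rule mat_mult_left_right_inverse[OF Bt(1) D])
    have DB: "?D * B = 1\<^sub>m n"
      using arg_cong[OF D(2), of transpose_mat] B(1) D(1) by (simp add: transpose_mult)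
    have Bz: "?B * z = z * ?B" if "z \<in> Z" for z using tc B that by blast
    have Dz: "D * z = z * D" if "z \<in> Z" for z
      using that Z by (intro commutes_inverse[of ?B n D z]) (auto simp: Bt D DB' Bz B)
    have Dtz: "?D * z = z * ?D" if "z \<in> Z" for z using tc D(1) Dz that by blast
    have ee: "M * e = e * M \<and> M * e' = e' * M" if "M \<in> {B, D, ?B, ?D}" for M
      using that comm_e[OF B(1) B(2)[OF J(1)]] comm_e[OF D(1) Dz[OF J(1)]]
        comm_e[OF Bt(1) Bz[OF J(1)]] comm_e[OF Bt(2) Dtz[OF J(1)]] by auto
    have four: "(P * Q) * (R * S) = P * (Q * R) * S"
      if "P \<in> carrier_mat n n" "Q \<in> carrier_mat n n" "R \<in> carrier_mat n n" "S \<in> carrier_mat n n"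
      for P Q R S :: "'a mat"
      using that by (simp add: assoc_mult_mat[of _ n n _ n _ n])
    have T: "transpose_mat (B * e + D * e') = e' * ?B + e * ?D"
      using B D e by (simp add: transpose_add[of _ n n] transpose_mult[of _ n n _ n])
    \<comment> \<open>The terms pairing \<open>B\<close> with \<open>B\<close> or \<open>D\<close>
      with \<open>D\<close> contain \<open>e' * e\<close> or \<open>e * e'\<close> and vanish; the
      mixed terms contribute \<open>e'\<close> and \<open>e\<close>.\<close>
    have "(e' * ?B + e * ?D) * (B * e + D * e') =
        e' * ?B * (B * e) + e * ?D * (B * e) + (e' * ?B * (D * e') + e * ?D * (D * e'))"
      using B D e Bt by (simp add: add_mult_distrib_mat[of _ n n _ _ n] mult_add_distrib_mat[of _ n n _ n])
    also have "e' * ?B * (B * e) = 0\<^sub>m n n"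
    proof -
      have "e' * ?B * (B * e) = ?B * e' * (e * B)" using ee by simp
      also have "\<dots> = ?B * (e' * e) * B" using four B Bt e by simp
      finally show ?thesis using e B Bt by simp
    qed
    also have "e' * ?B * (D * e') = e'" using four B D Bt e by simp
    also have "e * ?D * (B * e) = e" using four B D Bt e DB by simp
    also have "e * ?D * (D * e') = 0\<^sub>m n n"
    proof -
      have "e * ?D * (D * e') = ?D * e * (e' * D)" using ee by simp
      also have "\<dots> = ?D * (e * e') * D" using four D Bt e by simp
      finally show ?thesis using e D Bt by simp
    qed
    also have "0\<^sub>m n n + e + (e' + 0\<^sub>m n n) = 1\<^sub>m n"
      using e by simp
    finally have orth: "transpose_mat (B * e + D * e') * (B * e + D * e') = 1\<^sub>m n"
      unfolding T .
    moreover have "(B * e + D * e') * z = z * (B * e + D * e')" if z: "z \<in> Z" for z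
    proof -
      have zc: "z \<in> carrier_mat n n" using z Z by auto
      moreover have "e * z = z * e" "e' * z = z * e'" using comm_e[OF zc Z_J[OF z]] by auto
      ultimately show ?thesis using B D e Dz[OF z] z
        by (intro commutes_add commutes_mult) auto
    qed
    ultimately show ?thesis using B D e by (simp add: orthogonal_centralizer_def)
  qed
  fix A assume A: "A \<in> orthogonal_centralizer n Z"
  hence Ac: "A \<in> carrier_mat n n" "transpose_mat A * A = 1\<^sub>m n" "\<And>z. z \<in> Z \<Longrightarrow> A * z = z * A"
    by (auto simp: orthogonal_centralizer_def)
  define B where "B = (\<lambda>t. (1 - t) \<cdot>\<^sub>m 1\<^sub>m n + t \<cdot>\<^sub>m A)"
  have B: "B t \<in> carrier_mat n n" for t using Ac by (simp add: B_def)
  have Bz: "B t * z = z * B t" if "z \<in> Z" for t z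
    unfolding B_def using that Ac Z by (intro commutes_add commutes_smult) auto
  have Breg: "(\<lambda>t. B t $$ (i, j)) \<in> rational_on q" if "i < n" "j < n" for i j q
  proof -
    have "(\<lambda>t. B t $$ (i, j)) = poly [:1\<^sub>m n $$ (i, j), A $$ (i, j) - 1\<^sub>m n $$ (i, j):]"
      using that Ac by (auto simp: B_def algebra_simps)
    thus ?thesis using rational_on_poly by metis
  qed
  \<comment> \<open>With denominator 1, membership means being a polynomial function.\<close>
  have "(\<lambda>t. det (B t)) \<in> rational_on 1"
    by (rule rational_on_det[OF B Breg])
  then obtain q where q: "\<And>t. det (B t) = poly q t"
    unfolding rational_on_def by auto
  have B01: "B 0 = 1\<^sub>m n" "B 1 = A" using Ac by (auto simp: B_def intro!: eq_matI)
  have q01: "poly q 0 \<noteq> 0" "poly q 1 \<noteq> 0"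
    using q[of 0] q[of 1] orthogonal_centralizer_det[OF Z A] by (auto simp: B01)
  \<comment> \<open>The inverse transpose of \<open>B t\<close> by Cramer's rule, so that its
    entries are visibly rational with denominator \<open>q\<close>.\<close>
  define D where "D = (\<lambda>t. inverse (poly q t) \<cdot>\<^sub>m transpose_mat (adj_mat (B t)))"
  have D: "D t \<in> carrier_mat n n" for t using adj_mat(1)[OF B] by (simp add: D_def)
  have BD: "transpose_mat (B t) * D t = 1\<^sub>m n" if "poly q t \<noteq> 0" for t
  proof -
    have "transpose_mat (B t) * transpose_mat (adj_mat (B t)) = transpose_mat (adj_mat (B t) * B t)"
      using transpose_mult[OF adj_mat(1)[OF B] B] by metis
    also have "\<dots> = poly q t \<cdot>\<^sub>m 1\<^sub>m n"
      unfolding adj_mat(3)[OF B] q by (simp add: transpose_smult_mat)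
    finally have "transpose_mat (B t) * transpose_mat (adj_mat (B t)) = poly q t \<cdot>\<^sub>m 1\<^sub>m n" .
    moreover have "1 \<cdot>\<^sub>m 1\<^sub>m n = (1\<^sub>m n :: 'a mat)" by (intro eq_matI) auto
    ultimately show ?thesis using that B adj_mat(1)[OF B]
      by (simp add: D_def mult_smult_distrib[of _ n n _ n] smult_smult_mat)
  qed
  have Dreg: "(\<lambda>t. D t $$ (i, j)) \<in> rational_on q" if ij: "i < n" "j < n" for i j
  proof -
    have "D t $$ (i, j) = inverse (poly q t) * ((-1) ^ (i + j) * det (mat_delete (B t) i j))" for t
      using ij B[of t] adj_mat(1)[OF B, of t]
      by (simp add: D_def adj_mat_def cofactor_def)
    moreover have "(\<lambda>t. inverse (poly q t) * ((-1) ^ (i + j) * det (mat_delete (B t) i j)))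
        \<in> rational_on q"
    proof (intro rational_on_mult rational_on_inverse rational_on_const rational_on_det)
      show "mat_delete (B t) i j \<in> carrier_mat (n - 1) (n - 1)" for t
        using B[of t] by (rule mat_delete_carrier)
      fix k l assume kl: "k < n - 1" "l < n - 1"
      have "mat_delete (B t) i j $$ (k, l) =
          B t $$ (if k < i then k else Suc k, if l < j then l else Suc l)" for t
        using kl B[of t] by (auto simp: mat_delete_def)
      thus "(\<lambda>t. mat_delete (B t) i j $$ (k, l)) \<in> rational_on q"
        using kl by (simp add: Breg)
    qed
    ultimately show ?thesis by simp
  qed
  define h where "h = (\<lambda>t. B t * e + D t * e')"
  have h: "h t \<in> orthogonal_centralizer n Z" if "poly q t \<noteq> 0" for t
    unfolding h_def by (intro key B Bz D BD that)
  have entry_reg: "(\<lambda>t. (M t * c) $$ (i, j)) \<in> rational_on q"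
    if "\<And>t. M t \<in> carrier_mat n n" "c \<in> carrier_mat n n" "i < n" "j < n"
      "\<And>i j. i < n \<Longrightarrow> j < n \<Longrightarrow> (\<lambda>t. M t $$ (i, j)) \<in> rational_on q" for M c i j
  proof -
    have "(M t * c) $$ (i, j) = (\<Sum>k\<in>{0..<n}. M t $$ (i, k) * c $$ (k, j))" for t
      using that(1)[of t] that(2-4) by (simp add: scalar_prod_def)
    moreover have "(\<lambda>t. \<Sum>k\<in>{0..<n}. M t $$ (i, k) * c $$ (k, j)) \<in> rational_on q"
      by (intro rational_on_sum rational_on_mult rational_on_const that(5)) (use that(3) in auto)
    ultimately show ?thesis by simp
  qed
  have hc: "h t \<in> carrier_mat n n" for t using B[of t] D[of t] e by (simp add: h_def)
  have hreg: "(\<lambda>t. h t $$ (i, j)) \<in> rational_on q" if ij: "i < n" "j < n" for i j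
  proof -
    have "h t $$ (i, j) = (B t * e) $$ (i, j) + (D t * e') $$ (i, j)" for t
      using ij B[of t] D[of t] e by (simp add: h_def)
    thus ?thesis using entry_reg[of B e i j] entry_reg[of D e' i j] B D e ij Breg Dreg
      by (simp add: rational_on_add)
  qed
  have "(\<lambda>t. inverse (det (h t))) \<in> rational_on q"
  proof -
    obtain p k where pk: "\<And>t. poly q t \<noteq> 0 \<Longrightarrow> det (h t) = poly p t / poly q t ^ k"
      using rational_on_det[of h n q] hc hreg unfolding rational_on_def by auto
    \<comment> \<open>An orthogonal matrix has determinant 1 or -1, so the inverse determinant is
      again a rational function.\<close>
    have "inverse (det (h t)) = det (h t)" if "poly q t \<noteq> 0" for t
      using orthogonal_centralizer_det[OF Z h[OF that]] by (metis inverse_unique)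
    with pk show ?thesis by (intro rational_onI) simp
  qed
  moreover have "h t \<in> carrier (GL n)" if "poly q t \<noteq> 0" for t
    using h[OF that] orthogonal_centralizer_GL[OF Z] by blast
  moreover have "q \<noteq> 0" using q01 by auto
  ultimately have "connectedin (zariski UNIV n) (h ` {t. poly q t \<noteq> 0})"
    using hreg by (intro connectedin_rational_curve) auto
  moreover have "1\<^sub>m n \<in> h ` {t. poly q t \<noteq> 0}"
  proof
    have "D 0 = 1\<^sub>m n" using BD[of 0] q01 D[of 0] by (simp add: B01)
    thus "1\<^sub>m n = h 0" using e by (simp add: h_def B01)
  qed (use q01 in simp)
  moreover have "A \<in> h ` {t. poly q t \<noteq> 0}"
  proof
    have AA: "A * transpose_mat A = 1\<^sub>m n" by (rule orthogonal_centralizer_right_inverse[OF Z A])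
    \<comment> \<open>The contragredient of the orthogonal matrix \<open>A\<close> is
      \<open>A\<close> itself, so the curve ends at \<open>A\<close>.\<close>
    have "D 1 = A * transpose_mat A * D 1" using AA D[of 1] by simp
    also have "\<dots> = A * (transpose_mat A * D 1)" using Ac D[of 1] by (intro assoc_mult_mat) auto
    also have "\<dots> = A" using BD[of 1] q01 Ac by (simp add: B01)
    finally have "h 1 = A * e + A * e'" by (simp add: h_def B01)
    also have "\<dots> = A * (e + e')" by (rule mult_add_distrib_mat[OF Ac(1) e(1,2), symmetric])
    finally show "A = h 1" using e(3) Ac(1) by simp
  qed (use q01 in simp)
  moreover have "h ` {t. poly q t \<noteq> 0} \<subseteq> orthogonal_centralizer n Z" using h by auto
  ultimately show "\<exists>S. connectedin (zariski UNIV n) S \<and> 1\<^sub>m n \<in> S \<and> A \<in> S \<and>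
      S \<subseteq> orthogonal_centralizer n Z" by blast
qed

section \<open>Functoriality for an inclusion\<close>

context
  fixes n and G :: "'k :: field_char_0 alg_closure mat set"
  assumes G: "subgroup G (GL n)"
begin

lemma subgroup_GL_carrier: "g \<in> G \<Longrightarrow> g \<in> carrier_mat n n"
  using subgroup.mem_carrier[OF G] by (simp add: carrier_GL)

lemma subgroup_GL_inv:
  assumes "g \<in> G"
  shows "inv\<^bsub>GL n\<^esub> g \<in> G" "inv\<^bsub>GL n\<^esub> g * g = 1\<^sub>m n" "g * inv\<^bsub>GL n\<^esub> g = 1\<^sub>m n"
  using subgroup.m_inv_closed[OF G assms] subgroup.mem_carrier[OF G assms]
    group.l_inv[OF group_GL, of g] group.r_inv[OF group_GL, of g] by auto

lemma cocycles_carrier: "c \<in> cocycles G \<Longrightarrow> \<gamma> \<in> Gal \<Longrightarrow> c \<gamma> \<in> carrier_mat n n"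
  using subgroup_GL_carrier by (auto simp: cocycles_def PiE_def Pi_def)

lemma cohomologous_refl: "c \<in> cocycles G \<Longrightarrow> (c, c) \<in> cohomologous n G"
proof -
  assume c: "c \<in> cocycles G"
  have "map_mat \<gamma> (1\<^sub>m n) = 1\<^sub>m n" if "\<gamma> \<in> Gal" for \<gamma> :: "'k alg_closure \<Rightarrow> 'k alg_closure"
  proof -
    interpret field_hom \<gamma> using that by (simp add: Gal_def)
    show ?thesis by (rule mat_hom_one)
  qed
  moreover have "1\<^sub>m n \<in> G" using subgroup.one_closed[OF G] by simp
  moreover have "inv\<^bsub>GL n\<^esub> (1\<^sub>m n) = (1\<^sub>m n :: 'k alg_closure mat)"
    using monoid.inv_one[OF group.is_monoid[OF group_GL], of n] by simp
  moreover have "1\<^sub>m n * c \<gamma> * 1\<^sub>m n = c \<gamma>" if "\<gamma> \<in> Gal" for \<gamma>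
    using cocycles_carrier[OF c that] by simp
  ultimately show ?thesis using c
    by (auto simp: cohomologous_def intro!: bexI[of _ "1\<^sub>m n"])
qed

lemma cohomologous_sym:
  assumes "(c, d) \<in> cohomologous n G" shows "(d, c) \<in> cohomologous n G"
proof -
  obtain g where g: "g \<in> G" and eq: "\<And>\<gamma>. \<gamma> \<in> Gal \<Longrightarrow> d \<gamma> = inv\<^bsub>GL n\<^esub> g * c \<gamma> * map_mat \<gamma> g"
    and cd: "c \<in> cocycles G" "d \<in> cocycles G"
    using assms by (auto simp: cohomologous_def)
  let ?h = "inv\<^bsub>GL n\<^esub> g"
  note h = subgroup_GL_inv[OF g]
  have carr: "g \<in> carrier_mat n n" "?h \<in> carrier_mat n n" using g h subgroup_GL_carrier by auto
  have "c \<gamma> = inv\<^bsub>GL n\<^esub> ?h * d \<gamma> * map_mat \<gamma> ?h" if \<gamma>: "\<gamma> \<in> Gal" for \<gamma>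
  proof -
    interpret field_hom \<gamma> using \<gamma> by (simp add: Gal_def)
    have cc: "c \<gamma> \<in> carrier_mat n n" using cocycles_carrier cd \<gamma> by blast
    have inv: "inv\<^bsub>GL n\<^esub> ?h = g"
      using group.inv_inv[OF group_GL] subgroup.mem_carrier[OF G g] by blast
    have "map_mat \<gamma> g * map_mat \<gamma> ?h = 1\<^sub>m n"
      using mat_hom_mult[OF carr] h(3) mat_hom_one by simp
    moreover have "g * (?h * c \<gamma> * map_mat \<gamma> g) * map_mat \<gamma> ?h
        = (g * ?h) * c \<gamma> * (map_mat \<gamma> g * map_mat \<gamma> ?h)"
      using carr cc by (simp add: assoc_mult_mat[of _ n n _ n _ n])
    ultimately show ?thesis using h(3) cc unfolding inv eq[OF \<gamma>] by simp
  qed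
  with h(1) cd show ?thesis by (auto simp: cohomologous_def)
qed

lemma cohomologous_trans:
  assumes "(b, c) \<in> cohomologous n G" "(c, d) \<in> cohomologous n G"
  shows "(b, d) \<in> cohomologous n G"
proof -
  obtain g h where g: "g \<in> G" "\<And>\<gamma>. \<gamma> \<in> Gal \<Longrightarrow> c \<gamma> = inv\<^bsub>GL n\<^esub> g * b \<gamma> * map_mat \<gamma> g"
    and h: "h \<in> G" "\<And>\<gamma>. \<gamma> \<in> Gal \<Longrightarrow> d \<gamma> = inv\<^bsub>GL n\<^esub> h * c \<gamma> * map_mat \<gamma> h"
    and bd: "b \<in> cocycles G" "d \<in> cocycles G"
    using assms by (auto simp: cohomologous_def)
  have carr: "g \<in> carrier_mat n n" "inv\<^bsub>GL n\<^esub> g \<in> carrier_mat n n"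
    "h \<in> carrier_mat n n" "inv\<^bsub>GL n\<^esub> h \<in> carrier_mat n n"
    using g h subgroup_GL_inv subgroup_GL_carrier by auto
  have gh: "inv\<^bsub>GL n\<^esub> (g * h) = inv\<^bsub>GL n\<^esub> h * inv\<^bsub>GL n\<^esub> g"
    using group.inv_mult_group[OF group_GL, of g n h] subgroup.mem_carrier[OF G] g h by simp
  have "d \<gamma> = inv\<^bsub>GL n\<^esub> (g * h) * b \<gamma> * map_mat \<gamma> (g * h)" if \<gamma>: "\<gamma> \<in> Gal" for \<gamma>
  proof -
    interpret field_hom \<gamma> using \<gamma> by (simp add: Gal_def)
    have "b \<gamma> \<in> carrier_mat n n" using cocycles_carrier bd \<gamma> by blast
    thus ?thesis using carr
      by (simp add: gh g(2)[OF \<gamma>] h(2)[OF \<gamma>] mat_hom_mult[OF carr(1,3)] assoc_mult_mat[of _ n n _ n _ n])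
  qed
  moreover have "g * h \<in> G" using subgroup.m_closed[OF G g(1) h(1)] by simp
  ultimately show ?thesis using bd by (auto simp: cohomologous_def)
qed

lemma H1_class_eqI: "(c, d) \<in> cohomologous n G \<Longrightarrow> H1_class n G c = H1_class n G d"
  unfolding H1_class_def using cohomologous_sym cohomologous_trans by blast

lemma H1_class_eqD: "d \<in> cocycles G \<Longrightarrow> H1_class n G c = H1_class n G d \<Longrightarrow> (c, d) \<in> cohomologous n G"
  unfolding H1_class_def using cohomologous_refl by blast

end

text \<open>Cocycles cohomologous in \<open>T\<close> are cohomologous in \<open>G\<close>, so
  transitivity makes the image of a whole class equal to the class in \<open>G\<close> of one
  representative.\<close>

lemma H1_map_inclusion:
  assumes T: "subgroup T (GL n)" and G: "subgroup G (GL n)" and "T \<subseteq> G" and c: "c \<in> cocycles T"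
  shows "H1_map n G (\<lambda>A. A) (H1_class n T c) = H1_class n G c"
proof -
  have sub: "cohomologous n T \<subseteq> cohomologous n G"
    using \<open>T \<subseteq> G\<close> unfolding cohomologous_def cocycles_def by fastforce
  have "compose Gal (\<lambda>A. A) d = d" if "d \<in> cocycles T" for d
    using that by (auto simp: compose_def cocycles_def PiE_def extensional_def fun_eq_iff)
  moreover have "H1_class n T c \<subseteq> cocycles T" by (auto simp: H1_class_def cohomologous_def)
  ultimately have "compose Gal (\<lambda>A. A) ` H1_class n T c = H1_class n T c" by force
  moreover have "cohomologous n G `` H1_class n T c = H1_class n G c"
    using sub cohomologous_refl[OF T c] cohomologous_trans[OF G]
    unfolding H1_class_def by blast
  ultimately show ?thesis by (simp add: H1_map_def)
qed

text \<open>The classes of \<open>c\<close> and \<open>d\<close> have the same image \<open>x\<close>, so those of \<open>c c\<close> and of \<open>c d\<close> both map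
  to \<open>x\<^sup>2\<close>.\<close>

lemma functorial_group_structure_cohomologous:
  fixes M :: "nat \<Rightarrow> 'k :: field_char_0 alg_closure mat set \<Rightarrow> 'k cochain set monoid"
    and T G :: "'k alg_closure mat set"
  assumes M: "functorial_group_structure M"
    and T: "reductive_group n T" "torus n T" and G: "reductive_group n G" and "T \<subseteq> G"
    and cd: "c \<in> cocycles T" "d \<in> cocycles T" "(c, d) \<in> cohomologous n G"
    and cocycle_mult: "cocycle_mult c c \<in> cocycles T" "cocycle_mult c d \<in> cocycles T"
  shows "(cocycle_mult c c, cocycle_mult c d) \<in> cohomologous n G"
proof -
  have sT: "subgroup T (GL n)" and sG: "subgroup G (GL n)"
    using T G by (auto simp: reductive_group_def alg_group_def)
  let ?f = "H1_map n G (\<lambda>A. A)"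
  have "alg_hom base_field n T n G (\<lambda>A. A)"
    using \<open>T \<subseteq> G\<close> by (auto simp: alg_hom_def hom_def intro!: bexI[OF _ regular.entry])
  hence f: "?f \<in> hom (M n T) (M n G)"
    using M T G by (auto simp: functorial_group_structure_def)
  have carrier: "H1_class n T a \<in> carrier (M n T)" if "a \<in> cocycles T" for a
    using M T that by (auto simp: functorial_group_structure_def H1_def H1_class_def quotient_def)
  have prod: "H1_class n T a \<otimes>\<^bsub>M n T\<^esub> H1_class n T b = H1_class n T (cocycle_mult a b)"
    if "a \<in> cocycles T" "b \<in> cocycles T" for a b
    using M T that by (auto simp: functorial_group_structure_def)
  have incl: "?f (H1_class n T a) = H1_class n G a" if "a \<in> cocycles T" for a
    using H1_map_inclusion[OF sT sG \<open>T \<subseteq> G\<close> that] .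
  have eq: "?f (H1_class n T d) = ?f (H1_class n T c)"
    using H1_class_eqI[OF sG cd(3)] cd incl by simp
  have "H1_class n G (cocycle_mult c c) = ?f (H1_class n T c \<otimes>\<^bsub>M n T\<^esub> H1_class n T c)"
    using prod cd cocycle_mult incl by simp
  also have "\<dots> = ?f (H1_class n T c \<otimes>\<^bsub>M n T\<^esub> H1_class n T d)"
    using hom_mult[OF f] carrier cd eq by simp
  also have "\<dots> = H1_class n G (cocycle_mult c d)"
    using prod cd cocycle_mult incl by simp
  finally have "H1_class n G (cocycle_mult c c) = H1_class n G (cocycle_mult c d)" .
  moreover have "cocycle_mult c d \<in> cocycles G"
    using cocycle_mult(2) \<open>T \<subseteq> G\<close> unfolding cocycles_def by fastforce
  ultimately show ?thesis using H1_class_eqD[OF sG] by blast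
qed

section \<open>The unitary group and its torus\<close>

lemma mult_mat_2:
  assumes "A \<in> carrier_mat 2 2" "B \<in> carrier_mat 2 2" "i < 2" "j < 2"
  shows "(A * B) $$ (i, j) = A $$ (i, 0) * B $$ (0, j) + A $$ (i, 1) * B $$ (1, j)"
  using assms by (simp add: scalar_prod_def numeral_2_eq_2)

lemma mult_mat_4:
  assumes "A \<in> carrier_mat 4 4" "B \<in> carrier_mat 4 4" "i < 4" "j < 4"
  shows "(A * B) $$ (i, j) = A $$ (i, 0) * B $$ (0, j) + A $$ (i, 1) * B $$ (1, j) +
    A $$ (i, 2) * B $$ (2, j) + A $$ (i, 3) * B $$ (3, j)"
  using assms by (simp add: scalar_prod_def numeral_eq_Suc)

lemma all_less_2: "(\<forall>i<2. P i) \<longleftrightarrow> P 0 \<and> P (1 :: nat)"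
  by (auto simp: less_2_cases_iff)

lemma all_less_4: "(\<forall>i<4. P i) \<longleftrightarrow> P 0 \<and> P 1 \<and> P 2 \<and> P (3 :: nat)"
  by (auto simp: numeral_eq_Suc less_Suc_eq)

declare index_mult_mat(1) [simp del] One_nat_def [simp del]

lemma mult_carrier_square [simp]:
  "A \<in> carrier_mat n n \<Longrightarrow> B \<in> carrier_mat n n \<Longrightarrow> A * B \<in> carrier_mat n n"
  by simp

lemma mat_eq_2:
  assumes "A \<in> carrier_mat 2 2" "B \<in> carrier_mat 2 2"
  shows "A = B \<longleftrightarrow> (\<forall>i<2. \<forall>j<2. A $$ (i, j) = B $$ (i, j))"
  using assms by (auto simp: mat_eq_iff)

lemma mat_eq_4:
  assumes "A \<in> carrier_mat 4 4" "B \<in> carrier_mat 4 4"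
  shows "A = B \<longleftrightarrow> (\<forall>i<4. \<forall>j<4. A $$ (i, j) = B $$ (i, j))"
  using assms by (auto simp: mat_eq_iff)

text \<open>Trace and determinant of a nilpotent matrix vanish: the determinant is multiplicative,
  and once it is 0 the powers of \<open>N\<close> are powers of the trace times
  \<open>N\<close>.\<close>

lemma nilpotent_mat_2:
  fixes N :: "'a :: field mat"
  assumes N: "N \<in> carrier_mat 2 2" and nil: "N ^\<^sub>m k = 0\<^sub>m 2 2"
  shows "N $$ (0, 0) + N $$ (1, 1) = 0" "N $$ (0, 0) * N $$ (1, 1) = N $$ (0, 1) * N $$ (1, 0)"
proof -
  define \<delta> where "\<delta> = (\<lambda>A. A $$ (0, 0) * A $$ (1, 1) - A $$ (0, 1) * A $$ (1, 0) :: 'a)"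
  have \<delta>_mult: "\<delta> (A * B) = \<delta> A * \<delta> B" if "A \<in> carrier_mat 2 2" "B \<in> carrier_mat 2 2" for A B
    using that by (simp add: \<delta>_def mult_mat_2 algebra_simps)
  have "\<delta> (N ^\<^sub>m l) = \<delta> N ^ l" for l
    by (induction l) (use N in \<open>simp_all add: \<delta>_mult\<close>, simp_all add: \<delta>_def)
  from this[of k] nil have "\<delta> N ^ k = 0" by (simp add: \<delta>_def)
  hence "\<delta> N = 0" by simp
  thus det: "N $$ (0, 0) * N $$ (1, 1) = N $$ (0, 1) * N $$ (1, 0)"
    by (simp add: \<delta>_def)
  define t where "t = N $$ (0, 0) + N $$ (1, 1)"
  \<comment> \<open>Cayley-Hamilton for determinant 0.\<close>
  have NN: "N * N = t \<cdot>\<^sub>m N"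
    using N det by (subst mat_eq_2) (auto simp: all_less_2 mult_mat_2 t_def algebra_simps)
  have pow: "N ^\<^sub>m Suc l = t ^ l \<cdot>\<^sub>m N" for l
  proof (induction l)
    case 0
    show ?case using N by (intro eq_matI) auto
  next
    case (Suc l)
    have "N ^\<^sub>m Suc (Suc l) = t ^ l \<cdot>\<^sub>m N * N" using Suc by simp
    also have "\<dots> = t ^ Suc l \<cdot>\<^sub>m N"
      using N by (simp add: mult_smult_assoc_mat[of N 2 2 N 2] NN smult_smult_mat mult.commute)
    finally show ?case .
  qed
  have "t ^ k \<cdot>\<^sub>m N = 0\<^sub>m 2 2" using pow[of k] nil N by simp
  hence "t ^ k * N $$ (0, 0) = 0" "t ^ k * N $$ (1, 1) = 0"
    using N by (auto simp: mat_eq_iff all_less_2)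
  hence "t ^ k * (N $$ (0, 0) + N $$ (1, 1)) = 0" by (simp only: distrib_left add_0)
  hence "t ^ k * t = 0" by (simp only: t_def)
  thus "N $$ (0, 0) + N $$ (1, 1) = 0" by (auto simp: t_def[symmetric])
qed

text \<open>In the K-basis (1, 0), (i, 0), (0, 1), (0, i) of K(i)^2, \<open>J4\<close> is
  multiplication by i, \<open>D4 a b\<close> is diag(a, b), and \<open>W4\<close> exchanges the two
  coordinates.\<close>

definition J4 :: "'a :: comm_ring_1 mat"
  where "J4 = mat 4 4 (\<lambda>ij. if ij \<in> {(1, 0), (3, 2)} then 1 else if ij \<in> {(0, 1), (2, 3)} then -1 else 0)"

definition D4 :: "'a \<Rightarrow> 'a \<Rightarrow> 'a :: comm_ring_1 mat"
  where "D4 a b = mat 4 4 (\<lambda>(i, j). if i \<noteq> j then 0 else if i < 2 then a else b)"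

definition W4 :: "'a :: comm_ring_1 mat"
  where "W4 = mat 4 4 (\<lambda>ij. if ij \<in> {(0, 2), (1, 3), (2, 0), (3, 1)} then 1 else 0)"

text \<open>The unitary group in two variables for the extension \<open>K(i)/K\<close>: a matrix commuting with \<open>J4\<close>
  is \<open>K(i)\<close>-linear on \<open>K(i)\<^sup>2 = K\<^sup>4\<close>.\<close>

definition unitary_group_2 :: "'a :: comm_ring_1 mat set"
  where "unitary_group_2 = orthogonal_centralizer 4 {J4}"

text \<open>Commuting with diag(1, -1) means preserving both coordinate lines, so this is the
  product of two norm-one tori of K(i)/K, in the same form as the full group.\<close>

definition unitary_torus_2 :: "'a :: comm_ring_1 mat set"
  where "unitary_torus_2 = orthogonal_centralizer 4 {J4, D4 1 (-1)}"

lemma carrier_J4 [simp]: "J4 \<in> carrier_mat 4 4"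
  and carrier_D4 [simp]: "D4 a b \<in> carrier_mat 4 4"
  and carrier_W4 [simp]: "W4 \<in> carrier_mat 4 4"
  and dim_4 [simp]: "dim_row J4 = 4" "dim_col J4 = 4" "dim_row (D4 a b) = 4" "dim_col (D4 a b) = 4"
    "dim_row W4 = 4" "dim_col W4 = 4"
  by (simp_all add: J4_def D4_def W4_def)

lemma index_4 [simp]:
  "i < 4 \<Longrightarrow> j < 4 \<Longrightarrow> J4 $$ (i, j) =
    (if (i, j) \<in> {(1, 0), (3, 2)} then 1 else if (i, j) \<in> {(0, 1), (2, 3)} then -1 else 0)"
  "i < 4 \<Longrightarrow> j < 4 \<Longrightarrow> D4 a b $$ (i, j) = (if i \<noteq> j then 0 else if i < 2 then a else b)"
  "i < 4 \<Longrightarrow> j < 4 \<Longrightarrow> W4 $$ (i, j) = (if (i, j) \<in> {(0, 2), (1, 3), (2, 0), (3, 1)} then 1 else 0)"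
  by (simp_all add: J4_def D4_def W4_def)

text \<open>Each 2x2 block is the matrix of multiplication by some x + iy, with first row x, -y and
  second row y, x; columns 0 and 2 therefore determine \<open>A\<close>.\<close>

lemma commutes_J4:
  assumes "A \<in> carrier_mat 4 4"
  shows "A * J4 = J4 * A \<longleftrightarrow>
    A $$ (0, 1) = - A $$ (1, 0) \<and> A $$ (1, 1) = A $$ (0, 0) \<and>
    A $$ (0, 3) = - A $$ (1, 2) \<and> A $$ (1, 3) = A $$ (0, 2) \<and>
    A $$ (2, 1) = - A $$ (3, 0) \<and> A $$ (3, 1) = A $$ (2, 0) \<and>
    A $$ (2, 3) = - A $$ (3, 2) \<and> A $$ (3, 3) = (A $$ (2, 2) :: 'a :: comm_ring_1)"
  using assms
  by (subst mat_eq_4) (simp_all add: all_less_4 mult_mat_4, metis minus_minus)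

lemma one_commutes_J4 [simp]: "1\<^sub>m 4 * J4 = J4 * 1\<^sub>m 4"
  by (simp add: left_mult_one_mat[OF carrier_J4] right_mult_one_mat[OF carrier_J4])

lemma commutes_D4:
  assumes "A \<in> carrier_mat 4 4"
  shows "A * D4 1 (-1) = D4 1 (-1) * A \<longleftrightarrow>
    (\<forall>i<2. \<forall>j\<in>{2, 3}. A $$ (i, j) = 0 \<and> A $$ (j, i) = (0 :: 'a :: field_char_0))"
  using assms
  by (subst mat_eq_4) (auto simp: all_less_4 all_less_2 mult_mat_4)

text \<open>For \<open>\<epsilon>\<^sup>2 = -1\<close>, the action of a matrix commuting with \<open>J4\<close> on an eigenspace of \<open>J4\<close>.\<close>

definition eigen_block :: "'a :: comm_ring_1 \<Rightarrow> 'a mat \<Rightarrow> 'a mat"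
  where "eigen_block \<epsilon> A = mat 2 2 (\<lambda>(i, j). A $$ (2 * i, 2 * j) + \<epsilon> * A $$ (2 * i + 1, 2 * j))"

lemma eigen_block_carrier [simp]: "eigen_block \<epsilon> A \<in> carrier_mat 2 2"
  and eigen_block_dim [simp]: "dim_row (eigen_block \<epsilon> A) = 2" "dim_col (eigen_block \<epsilon> A) = 2"
  by (simp_all add: eigen_block_def)

lemma eigen_block_index:
  "eigen_block \<epsilon> A $$ (0, 0) = A $$ (0, 0) + \<epsilon> * A $$ (1, 0)"
  "eigen_block \<epsilon> A $$ (0, 1) = A $$ (0, 2) + \<epsilon> * A $$ (1, 2)"
  "eigen_block \<epsilon> A $$ (1, 0) = A $$ (2, 0) + \<epsilon> * A $$ (3, 0)"
  "eigen_block \<epsilon> A $$ (1, 1) = A $$ (2, 2) + \<epsilon> * A $$ (3, 2)"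
  by (simp_all add: eigen_block_def numeral_eq_Suc)

text \<open>\<open>eigen_block\<close> replaces i by \<open>\<epsilon>\<close> in a matrix of
  numbers x + iy, and this substitution respects products because \<open>\<epsilon>\<close> is also
  a square root of -1.\<close>

lemma eigen_block_mult:
  assumes A: "A \<in> carrier_mat 4 4" "A * J4 = J4 * A" and B: "B \<in> carrier_mat 4 4"
    and \<epsilon>: "\<epsilon> * \<epsilon> = -1"
  shows "eigen_block \<epsilon> (A * B) = eigen_block \<epsilon> A * eigen_block \<epsilon> B"
proof -
  have \<epsilon>': "\<epsilon> * (\<epsilon> * x) = - x" for x using \<epsilon> by (simp flip: mult.assoc)
  have "eigen_block \<epsilon> A * eigen_block \<epsilon> B \<in> carrier_mat 2 2" by simp
  with A(2)[unfolded commutes_J4[OF A(1)]] A(1) B show ?thesis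
    by (subst mat_eq_2)
      (simp_all add: all_less_2 mult_mat_2 mult_mat_4 eigen_block_index algebra_simps \<epsilon>'
       )
qed

lemma eigen_block_one: "eigen_block \<epsilon> (1\<^sub>m 4) = 1\<^sub>m 2"
  by (subst mat_eq_2) (simp_all add: all_less_2 eigen_block_index)

lemma eigen_block_minus:
  assumes "A \<in> carrier_mat 4 4" "B \<in> carrier_mat 4 4"
  shows "eigen_block \<epsilon> (A - B) = eigen_block \<epsilon> A - eigen_block \<epsilon> B"
  using assms by (subst mat_eq_2)
    (simp_all add: all_less_2 eigen_block_index algebra_simps minus_carrier_mat)

text \<open>The two values x + \<epsilon> y and x - \<epsilon> y recover x and y in characteristic
  0, and commuting with \<open>J4\<close> then fixes the remaining columns.\<close>

lemma eigen_block_eqI: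
  assumes "A \<in> carrier_mat 4 4" "A * J4 = J4 * A" "B \<in> carrier_mat 4 4" "B * J4 = J4 * B"
    and \<epsilon>: "\<epsilon> * \<epsilon> = (-1 :: 'a :: field_char_0)"
    and eq: "eigen_block \<epsilon> A = eigen_block \<epsilon> B" "eigen_block (-\<epsilon>) A = eigen_block (-\<epsilon>) B"
  shows "A = B"
proof -
  have *: "x = x' \<and> y = y'" if "x + \<epsilon> * y = x' + \<epsilon> * y'" "x + (-\<epsilon>) * y = x' + (-\<epsilon>) * y'" for x y x' y'
  proof -
    have "2 * x = 2 * x'"
      using arg_cong2[OF that, of "(+)"] by (simp add: algebra_simps)
    moreover have "\<epsilon> \<noteq> 0" using \<epsilon> by auto
    ultimately show ?thesis using that by simp
  qed
  have "eigen_block s A $$ (i, j) = eigen_block s B $$ (i, j)" if "s = \<epsilon> \<or> s = -\<epsilon>" for s i j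
    using that eq by metis
  note idx = this[of _ 0 0] this[of _ 0 1] this[of _ 1 0] this[of _ 1 1]
  have "A $$ (0, 0) = B $$ (0, 0) \<and> A $$ (1, 0) = B $$ (1, 0)"
    "A $$ (0, 2) = B $$ (0, 2) \<and> A $$ (1, 2) = B $$ (1, 2)"
    "A $$ (2, 0) = B $$ (2, 0) \<and> A $$ (3, 0) = B $$ (3, 0)"
    "A $$ (2, 2) = B $$ (2, 2) \<and> A $$ (3, 2) = B $$ (3, 2)"
    using idx unfolding eigen_block_index by (intro *; blast)+
  thus ?thesis
    using assms(2)[unfolded commutes_J4[OF assms(1)]] assms(4)[unfolded commutes_J4[OF assms(3)]]
    by (subst mat_eq_4[OF assms(1,3)]) (simp add: all_less_4)
qed

text \<open>The block of a unipotent matrix is unipotent, so its difference from 1 has trace and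
  determinant 0.\<close>

lemma eigen_block_unipotent:
  fixes A :: "'a :: field mat"
  assumes A: "A \<in> carrier_mat 4 4" "A * J4 = J4 * A" and \<epsilon>: "\<epsilon> * \<epsilon> = -1"
    and uni: "unipotent_mat 4 A"
  defines "P \<equiv> eigen_block \<epsilon> A"
  shows "P $$ (0, 0) + P $$ (1, 1) = 2"
    "(P $$ (0, 0) - 1) * (P $$ (1, 1) - 1) = P $$ (0, 1) * P $$ (1, 0)"
proof -
  let ?N = "A - 1\<^sub>m 4"
  have N: "?N \<in> carrier_mat 4 4" using A by auto
  have NJ: "?N * J4 = J4 * ?N"
    using A(2)[unfolded commutes_J4[OF A(1)]] A(1) unfolding commutes_J4[OF N] by simp
  obtain k where k: "?N ^\<^sub>m k = 0\<^sub>m 4 4" using uni by (auto simp: unipotent_mat_def)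
  have "?N ^\<^sub>m l * J4 = J4 * ?N ^\<^sub>m l \<and> eigen_block \<epsilon> (?N ^\<^sub>m l) = eigen_block \<epsilon> ?N ^\<^sub>m l" for l
  proof (induction l)
    case 0
    show ?case using A
      by (simp add: eigen_block_one)
  next
    case (Suc l)
    have "?N ^\<^sub>m l \<in> carrier_mat 4 4" using N by (rule pow_carrier_mat)
    with Suc N NJ \<epsilon> show ?case
      by (auto simp: eigen_block_mult intro!: commutes_mult[of _ 4])
  qed
  from this[of k] k have "eigen_block \<epsilon> ?N ^\<^sub>m k = eigen_block \<epsilon> (0\<^sub>m 4 4)" by simp
  also have "\<dots> = 0\<^sub>m 2 2"
    by (subst mat_eq_2) (simp_all add: all_less_2 eigen_block_index)
  finally have "eigen_block \<epsilon> ?N ^\<^sub>m k = 0\<^sub>m 2 2" .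
  from nilpotent_mat_2[OF eigen_block_carrier this]
  show "P $$ (0, 0) + P $$ (1, 1) = 2"
    "(P $$ (0, 0) - 1) * (P $$ (1, 1) - 1) = P $$ (0, 1) * P $$ (1, 0)"
    using A unfolding P_def
    by (simp_all add: eigen_block_minus eigen_block_one algebra_simps eigen_block_def)
qed

section \<open>Reductivity of the unitary group and its torus\<close>

lemma D4_mult: "D4 a b * D4 c d = D4 (a * c) (b * d)"
  by (subst mat_eq_4) (simp_all add: all_less_4 mult_mat_4)

lemma D4_one: "D4 1 1 = 1\<^sub>m 4"
  by (subst mat_eq_4) (simp_all add: all_less_4)

lemma transpose_4: "transpose_mat J4 = - J4" "transpose_mat (D4 a b) = D4 a b" "transpose_mat W4 = W4"
  by (subst mat_eq_4; simp add: all_less_4)+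

lemma J4_square: "J4 * J4 = - 1\<^sub>m 4"
  by (subst mat_eq_4) (simp_all add: all_less_4 mult_mat_4)

lemma W4_square: "W4 * W4 = 1\<^sub>m 4"
  by (subst mat_eq_4) (simp_all add: all_less_4 mult_mat_4)

lemma W4_conjugate_D4: "W4 * D4 a b * W4 = D4 b a"
  by (subst mat_eq_4) (simp_all add: all_less_4 mult_mat_4)

lemma D4_commutes: "D4 a b * J4 = J4 * D4 a b" "D4 a b * D4 c d = D4 c d * D4 a b"
  by (simp_all add: commutes_J4 D4_mult mult.commute)

lemma W4_commutes: "W4 * J4 = J4 * W4"
  by (simp add: commutes_J4)

lemma D4_in_torus: "a * a = 1 \<Longrightarrow> b * b = 1 \<Longrightarrow> D4 a b \<in> unitary_torus_2"
  by (auto simp: unitary_torus_2_def orthogonal_centralizer_def transpose_4 D4_mult D4_one D4_commutes)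

lemma W4_in_group: "W4 \<in> unitary_group_2"
  by (auto simp: unitary_group_2_def orthogonal_centralizer_def transpose_4 W4_square W4_commutes)

lemma torus_subset_group: "unitary_torus_2 \<subseteq> unitary_group_2"
  by (auto simp: unitary_torus_2_def unitary_group_2_def orthogonal_centralizer_def)

lemma in_unitary_group_2: "A \<in> unitary_group_2 \<longleftrightarrow> A \<in> carrier_mat 4 4 \<and> transpose_mat A * A = 1\<^sub>m 4 \<and> A * J4 = J4 * A"
  by (simp add: unitary_group_2_def orthogonal_centralizer_def)

lemma subgroup_unitary:
  "subgroup (unitary_group_2 :: 'a :: field mat set) (GL 4)"
  "subgroup (unitary_torus_2 :: 'a :: field mat set) (GL 4)"
  unfolding unitary_group_2_def unitary_torus_2_def
  by (intro subgroup_orthogonal_centralizer; simp)+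

lemma K_group_unitary: "K_group 4 unitary_group_2" "K_group 4 unitary_torus_2"
proof -
  have *: "0 \<in> base_field" "1 \<in> base_field" "-1 \<in> base_field"
    using to_ac_0 to_ac_1 to_ac_minus[of 1] by (metis rangeI)+
  show "K_group 4 unitary_group_2" "K_group 4 unitary_torus_2"
    unfolding unitary_group_2_def unitary_torus_2_def
    by (intro alg_group_orthogonal_centralizer; auto simp: *)+
qed

lemma connectedin_unitary:
  fixes i :: "'a :: field_char_0"
  assumes "i * i = -1"
  shows "connectedin (zariski UNIV 4) (unitary_group_2 :: 'a mat set)"
    "connectedin (zariski UNIV 4) (unitary_torus_2 :: 'a mat set)"
  unfolding unitary_group_2_def unitary_torus_2_def
  by (rule connectedin_orthogonal_centralizer[where J = J4 and i = i];
      use assms J4_square transpose_4 D4_commutes in auto)+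

lemma inv_unitary: "A \<in> unitary_group_2 \<Longrightarrow> inv\<^bsub>GL 4\<^esub> A = transpose_mat (A :: 'a :: field mat)"
  unfolding unitary_group_2_def by (rule inv_GL_orthogonal_centralizer) auto

text \<open>The products of \<open>u\<close> with its conjugates under \<open>D4 1 (-1)\<close> and \<open>W4\<close> are unipotent, so, if
  \<open>1 + N\<close> is the block of \<open>u\<close>, the traces of \<open>N g N g\<^sup>-\<^sup>1\<close> for these two \<open>g\<close> vanish.\<close>

lemma eigen_block_normal_unipotent:
  fixes U :: "'a :: field_char_0 mat set"
  assumes sub: "U \<subseteq> unitary_group_2" and uni: "\<And>u. u \<in> U \<Longrightarrow> unipotent_mat 4 u"
    and mult: "\<And>u v. u \<in> U \<Longrightarrow> v \<in> U \<Longrightarrow> u * v \<in> U"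
    and conj: "\<And>u. u \<in> U \<Longrightarrow> D4 1 (-1) * u * D4 1 (-1) \<in> U" "\<And>u. u \<in> U \<Longrightarrow> W4 * u * W4 \<in> U"
    and \<epsilon>: "\<epsilon> * \<epsilon> = -1" and u: "u \<in> U"
  shows "eigen_block \<epsilon> u = 1\<^sub>m 2"
proof -
  let ?P = "eigen_block \<epsilon> u"
  have carr: "v \<in> carrier_mat 4 4" "v * J4 = J4 * v" if "v \<in> U" for v
    using sub that by (auto simp: in_unitary_group_2)
  have tr: "eigen_block \<epsilon> v $$ (0, 0) + eigen_block \<epsilon> v $$ (1, 1) = 2" if "v \<in> U" for v
    using eigen_block_unipotent(1)[OF carr[OF that] \<epsilon> uni[OF that]] .
  \<comment> \<open>It is applied to \<open>g\<close> of order two, where \<open>g * u * g\<close>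
    is a conjugate of \<open>u\<close>.\<close>
  have block: "eigen_block \<epsilon> (u * (g * u * g)) =
      ?P * (eigen_block \<epsilon> g * ?P * eigen_block \<epsilon> g)"
    if "g \<in> carrier_mat 4 4" "g * J4 = J4 * g" for g
    using that carr[OF u] \<epsilon> by (simp add: eigen_block_mult commutes_mult[of _ 4] assoc_mult_mat[of _ 2 2 _ 2 _ 2])
  have D: "eigen_block \<epsilon> (D4 1 (-1)) = mat 2 2 (\<lambda>(i, j). if i \<noteq> j then 0 else if i = 0 then 1 else -1)"
    and W: "eigen_block \<epsilon> W4 = mat 2 2 (\<lambda>(i, j). if i = j then 0 else 1)"
    by (subst mat_eq_2; simp add: all_less_2 eigen_block_index)+
  \<comment> \<open>These are the entries of N; trace 0 gives d = -a and determinant 0 gives bc =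
    -a^2.\<close>
  define a b c d where "a = ?P $$ (0, 0) - 1" "b = ?P $$ (0, 1)" "c = ?P $$ (1, 0)" "d = ?P $$ (1, 1) - 1"
  have P: "?P $$ (0, 0) = 1 + a" "?P $$ (0, 1) = b" "?P $$ (1, 0) = c" "?P $$ (1, 1) = 1 + d"
    by (simp_all add: a_b_c_d_def)
  have ad: "d = - a" using tr[OF u] by (simp add: P eq_neg_iff_add_eq_0 algebra_simps)
  have bc: "b * c = - (a * a)"
    using eigen_block_unipotent(2)[OF carr[OF u] \<epsilon> uni[OF u]] by (simp add: P ad)
  have "(1 + a) * (1 + a) - b * c + (- (c * b) + (1 + d) * (1 + d)) = 2"
    using tr[OF mult[OF u conj(1)[OF u]]] unfolding block[OF carrier_D4 D4_commutes(1)] D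
    by (simp add: mult_mat_2 P algebra_simps)
  hence "4 * (a * a) = 0" using bc by (simp add: ad algebra_simps)
  hence a: "a = 0" by simp
  have "(1 + a) * (1 + d) + b * b + (c * c + (1 + d) * (1 + a)) = 2"
    using tr[OF mult[OF u conj(2)[OF u]]] unfolding block[OF carrier_W4 W4_commutes] W
    by (simp add: mult_mat_2 P algebra_simps)
  hence "b * b + c * c = 0" by (simp add: ad a algebra_simps)
  \<comment> \<open>Over K^s a sum of two squares can vanish nontrivially, but here one of
    \<open>b\<close> and \<open>c\<close> is 0, and then so is the other.\<close>
  moreover have "b * c = 0" using bc a by simp
  ultimately have "b = 0" "c = 0" by auto
  with a ad P show ?thesis
    by (subst mat_eq_2) (simp_all add: all_less_2)
qed

lemma obtain_sqrt_minus_one: obtains i :: "'a :: alg_closed_field" where "i * i = -1"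
proof -
  obtain i :: 'a where "i ^ 2 = -1" using nth_root_exists[of 2 "-1"] by auto
  thus ?thesis using that by (simp add: power2_eq_square)
qed

text \<open>It suffices that a unipotent element has trivial blocks for both \<open>i\<close> and
  \<open>-i\<close>. In the full group normality provides this; in the torus the blocks are
  diagonal.\<close>

lemma reductive_unitary:
  "reductive_group 4 (unitary_group_2 :: 'k :: field_char_0 alg_closure mat set)"
  "reductive_group 4 (unitary_torus_2 :: 'k alg_closure mat set)"
proof -
  obtain i :: "'k alg_closure" where i: "i * i = -1" using obtain_sqrt_minus_one by blast
  have one: "u = 1\<^sub>m 4"
    if "u \<in> unitary_group_2" "eigen_block i u = 1\<^sub>m 2" "eigen_block (-i) u = 1\<^sub>m 2" for u
    by (rule eigen_block_eqI[where \<epsilon> = i]) (use that i in \<open>auto simp: in_unitary_group_2 eigen_block_one\<close>)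
  have single: "U = {1\<^sub>m 4}" if "subgroup U (GL 4\<lparr>carrier := G\<rparr>)" "\<And>u. u \<in> U \<Longrightarrow> u = 1\<^sub>m 4"
    for U G :: "'k alg_closure mat set"
  proof -
    have "1\<^sub>m 4 \<in> U" using subgroup.one_closed[OF that(1)] by simp
    with that(2) show ?thesis by blast
  qed
  show "reductive_group 4 (unitary_group_2 :: 'k alg_closure mat set)"
    unfolding reductive_group_def
  proof (intro conjI allI impI K_group_unitary connectedin_unitary[OF i]; elim conjE)
    fix U :: "'k alg_closure mat set"
    assume U: "U \<lhd> GL 4\<lparr>carrier := unitary_group_2\<rparr>" "\<forall>u\<in>U. unipotent_mat 4 u"
    interpret normal U "GL 4\<lparr>carrier := unitary_group_2\<rparr>" by (rule U(1))
    have sub: "U \<subseteq> unitary_group_2" using subset by simp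
    \<comment> \<open>A symmetric orthogonal matrix is its own inverse, so this is conjugation by
      \<open>g\<close>.\<close>
    have conj: "g * u * g \<in> U" if "g \<in> unitary_group_2" "transpose_mat g = g" "u \<in> U" for g u
      using inv_op_closed2[of g u] that
        group.m_inv_consistent[OF group_GL subgroup_unitary(1) that(1)] by (simp add: inv_unitary)
    have D4: "D4 1 (-1) \<in> (unitary_group_2 :: 'k alg_closure mat set)"
      using D4_in_torus[of 1 "-1"] torus_subset_group by auto
    have mult: "u * v \<in> U" if "u \<in> U" "v \<in> U" for u v
      using subgroup.m_closed[OF subgroup_axioms that] by simp
    have "eigen_block \<epsilon> u = 1\<^sub>m 2" if "\<epsilon> * \<epsilon> = -1" "u \<in> U" for \<epsilon> u
      by (rule eigen_block_normal_unipotent[OF sub _ mult conj[OF D4] conj[OF W4_in_group] that])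
        (simp_all add: U(2)[rule_format] transpose_4)
    with sub i show "U = {1\<^sub>m 4}"
      by (intro single[OF subgroup_axioms] one) auto
  qed
  show "reductive_group 4 (unitary_torus_2 :: 'k alg_closure mat set)"
    unfolding reductive_group_def
  proof (intro conjI allI impI K_group_unitary connectedin_unitary[OF i]; elim conjE)
    fix U :: "'k alg_closure mat set"
    assume U: "U \<lhd> GL 4\<lparr>carrier := unitary_torus_2\<rparr>" "\<forall>u\<in>U. unipotent_mat 4 u"
    interpret normal U "GL 4\<lparr>carrier := unitary_torus_2\<rparr>" by (rule U(1))
    have sub: "U \<subseteq> unitary_torus_2" using subset by simp
    have "eigen_block \<epsilon> u = 1\<^sub>m 2" if \<epsilon>: "\<epsilon> * \<epsilon> = -1" and u: "u \<in> U" for \<epsilon> u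
    proof -
      have uc: "u \<in> carrier_mat 4 4" "u * J4 = J4 * u" "u * D4 1 (-1) = D4 1 (-1) * u"
        using sub u by (auto simp: unitary_torus_2_def orthogonal_centralizer_def)
      have offdiag: "eigen_block \<epsilon> u $$ (0, 1) = 0" "eigen_block \<epsilon> u $$ (1, 0) = 0"
        using uc(3)[unfolded commutes_D4[OF uc(1)]]
        by (auto simp: eigen_block_index all_less_2)
      \<comment> \<open>Two numbers with sum 2 whose differences from 1 have product 0 are both
        1.\<close>
      moreover have "eigen_block \<epsilon> u $$ (0, 0) = 1" "eigen_block \<epsilon> u $$ (1, 1) = 1"
        using eigen_block_unipotent[OF uc(1,2) \<epsilon> U(2)[rule_format, OF u]] offdiag
        by (auto)
      ultimately show ?thesis
        by (subst mat_eq_2) (simp_all add: all_less_2)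
    qed
    with sub torus_subset_group i show "U = {1\<^sub>m 4}"
      by (intro single[OF subgroup_axioms] one) auto
  qed
qed

section \<open>Splitting of the unitary torus\<close>

lemma diagonal_torus_2:
  "D \<in> diagonal_torus 2 \<longleftrightarrow> D \<in> carrier_mat 2 2 \<and> D $$ (0, 1) = 0 \<and> D $$ (1, 0) = 0 \<and>
    D $$ (0, 0) \<noteq> 0 \<and> D $$ (1, 1) \<noteq> (0 :: 'a :: field)"
  and det_diagonal_torus_2:
  "D \<in> diagonal_torus 2 \<Longrightarrow> det D = D $$ (0, 0) * D $$ (1, 1)"
proof -
  have diag: "diagonal_mat D \<longleftrightarrow> D $$ (0, 1) = 0 \<and> D $$ (1, 0) = 0" if "D \<in> carrier_mat 2 2"
    using that by (simp add: diagonal_mat_def all_less_2)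
  have det: "det D = D $$ (0, 0) * D $$ (1, 1)" if "D \<in> carrier_mat 2 2" "D $$ (1, 0) = 0"
  proof -
    have "upper_triangular D" using that by (simp add: upper_triangular_def all_less_2)
    from det_upper_triangular[OF this that(1)] that(1) show ?thesis
      by (simp add: diag_mat_def numeral_2_eq_2 One_nat_def)
  qed
  show "D \<in> diagonal_torus 2 \<longleftrightarrow> D \<in> carrier_mat 2 2 \<and> D $$ (0, 1) = 0 \<and> D $$ (1, 0) = 0 \<and>
      D $$ (0, 0) \<noteq> 0 \<and> D $$ (1, 1) \<noteq> 0"
    using diag det by (auto simp: diagonal_torus_def carrier_GL)
  show "D \<in> diagonal_torus 2 \<Longrightarrow> det D = D $$ (0, 0) * D $$ (1, 1)"
    using diag det by (auto simp: diagonal_torus_def carrier_GL)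
qed

text \<open>The matrix on K^4 of diag(a + ib, c + id) acting on K(i)^2.\<close>

definition rot4 :: "'a \<Rightarrow> 'a \<Rightarrow> 'a \<Rightarrow> 'a \<Rightarrow> 'a :: comm_ring_1 mat"
  where "rot4 a b c d = mat 4 4 (\<lambda>ij.
    if ij \<in> {(0, 0), (1, 1)} then a else if ij = (1, 0) then b else if ij = (0, 1) then -b else
    if ij \<in> {(2, 2), (3, 3)} then c else if ij = (3, 2) then d else if ij = (2, 3) then -d else 0)"

lemma carrier_rot4 [simp]: "rot4 a b c d \<in> carrier_mat 4 4"
  and dim_rot4 [simp]: "dim_row (rot4 a b c d) = 4" "dim_col (rot4 a b c d) = 4"
  by (simp_all add: rot4_def)

lemma index_rot4 [simp]:
  "i < 4 \<Longrightarrow> j < 4 \<Longrightarrow> rot4 a b c d $$ (i, j) =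
    (if (i, j) \<in> {(0, 0), (1, 1)} then a else if (i, j) = (1, 0) then b else if (i, j) = (0, 1) then -b else
     if (i, j) \<in> {(2, 2), (3, 3)} then c else if (i, j) = (3, 2) then d else if (i, j) = (2, 3) then -d else 0)"
  by (simp add: rot4_def)

lemma unitary_torus_2_iff:
  "A \<in> unitary_torus_2 \<longleftrightarrow>
    (\<exists>a b c d. A = rot4 a b c d \<and> a * a + b * b = 1 \<and> c * c + d * d = (1 :: 'a :: field_char_0))"
proof
  assume "A \<in> unitary_torus_2"
  hence A: "A \<in> carrier_mat 4 4" "transpose_mat A * A = 1\<^sub>m 4" "A * J4 = J4 * A"
    "A * D4 1 (-1) = D4 1 (-1) * A"
    by (auto simp: unitary_torus_2_def orthogonal_centralizer_def)
  note E = A(3)[unfolded commutes_J4[OF A(1)]] A(4)[unfolded commutes_D4[OF A(1)]]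
  have "A = rot4 (A $$ (0, 0)) (A $$ (1, 0)) (A $$ (2, 2)) (A $$ (3, 2))"
    using A(1) E by (subst mat_eq_4) (simp_all add: all_less_4 all_less_2)
  moreover have "A $$ (0, 0) * A $$ (0, 0) + A $$ (1, 0) * A $$ (1, 0) = 1"
    using arg_cong[OF A(2), of "\<lambda>M. M $$ (0, 0)"] A(1) E by (simp add: mult_mat_4 all_less_2)
  moreover have "A $$ (2, 2) * A $$ (2, 2) + A $$ (3, 2) * A $$ (3, 2) = 1"
    using arg_cong[OF A(2), of "\<lambda>M. M $$ (2, 2)"] A(1) E by (simp add: mult_mat_4 all_less_2)
  ultimately show "\<exists>a b c d. A = rot4 a b c d \<and> a * a + b * b = 1 \<and> c * c + d * d = 1" by blast
next
  assume "\<exists>a b c d. A = rot4 a b c d \<and> a * a + b * b = 1 \<and> c * c + d * d = 1"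
  then obtain a b c d where A: "A = rot4 a b c d" "a * a + b * b = 1" "c * c + d * d = 1" by blast
  have "transpose_mat A * A = 1\<^sub>m 4"
    unfolding A(1) using A(2,3)
    by (subst mat_eq_4) (simp_all add: all_less_4 mult_mat_4 algebra_simps)
  moreover have "A * J4 = J4 * A" "A * D4 1 (-1) = D4 1 (-1) * A"
    unfolding A(1) by (simp_all add: commutes_J4 commutes_D4 all_less_2)
  ultimately show "A \<in> unitary_torus_2"
    by (auto simp: unitary_torus_2_def orthogonal_centralizer_def A(1))
qed

lemma eigen_block_rot4:
  "eigen_block \<epsilon> (rot4 a b c d) $$ (0, 0) = a + \<epsilon> * b" "eigen_block \<epsilon> (rot4 a b c d) $$ (0, 1) = 0"
  "eigen_block \<epsilon> (rot4 a b c d) $$ (1, 0) = 0" "eigen_block \<epsilon> (rot4 a b c d) $$ (1, 1) = c + \<epsilon> * d"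
  by (simp_all add: eigen_block_index)

text \<open>The inverse of \<open>eigen_block i\<close> on the torus: \<open>z = x + i y\<close> and \<open>z\<^sup>-\<^sup>1 = x - i y\<close> when \<open>x\<^sup>2 + y\<^sup>2 = 1\<close>.\<close>

definition rot4_of_diagonal :: "'a :: field \<Rightarrow> 'a mat \<Rightarrow> 'a mat"
  where "rot4_of_diagonal i D = (let x = \<lambda>z. 1/2 * (z + inverse z); y = \<lambda>z. -i/2 * (z - inverse z) in
    rot4 (x (D $$ (0, 0))) (y (D $$ (0, 0))) (x (D $$ (1, 1))) (y (D $$ (1, 1))))"

lemma circle_parametrization:
  fixes i z x y :: "'a :: field_char_0"
  assumes i: "i * i = -1"
  shows "z \<noteq> 0 \<Longrightarrow> (1/2 * (z + inverse z)) * (1/2 * (z + inverse z)) +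
      (-i/2 * (z - inverse z)) * (-i/2 * (z - inverse z)) = 1"
    and "1/2 * (z + inverse z) + i * (-i/2 * (z - inverse z)) = z"
    and "x * x + y * y = 1 \<Longrightarrow> x + i * y \<noteq> 0"
    and "x * x + y * y = 1 \<Longrightarrow> 1/2 * ((x + i * y) + inverse (x + i * y)) = x"
    and "x * x + y * y = 1 \<Longrightarrow> -i/2 * ((x + i * y) - inverse (x + i * y)) = y"
proof -
  have i': "i * (i * a) = - a" for a using i by (simp flip: mult.assoc)
  show "(1/2 * (z + inverse z)) * (1/2 * (z + inverse z)) +
      (-i/2 * (z - inverse z)) * (-i/2 * (z - inverse z)) = 1" if "z \<noteq> 0"
  proof -
    have "(-i/2 * (z - inverse z)) * (-i/2 * (z - inverse z)) =
        (i * i) * (1/4 * ((z - inverse z) * (z - inverse z)))" by simp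
    also have "\<dots> = - (1/4 * ((z - inverse z) * (z - inverse z)))" using i by simp
    finally show ?thesis using that by (simp add: field_simps)
  qed
  show "1/2 * (z + inverse z) + i * (-i/2 * (z - inverse z)) = z"
  proof -
    have "i * (-i/2 * (z - inverse z)) = - (i * i) * (1/2 * (z - inverse z))" by simp
    also have "\<dots> = 1/2 * (z - inverse z)" using i by simp
    finally show ?thesis by (simp add: algebra_simps)
  qed
  assume xy: "x * x + y * y = 1"
  have prod: "(x + i * y) * (x - i * y) = 1"
    using xy by (simp add: algebra_simps i')
  thus "x + i * y \<noteq> 0" by auto
  have inv: "inverse (x + i * y) = x - i * y"
    using prod by (rule inverse_unique)
  show "1/2 * ((x + i * y) + inverse (x + i * y)) = x"
    unfolding inv by simp
  have "-i/2 * ((x + i * y) - (x - i * y)) = - (i * i) * y" by simp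
  thus "-i/2 * ((x + i * y) - inverse (x + i * y)) = y"
    unfolding inv using i by simp
qed

text \<open>On the torus the block for \<open>i\<close> is diag(a + ib, c + id), and on a + ib with
  a^2 + b^2 = 1 this coordinate is an isomorphism onto the multiplicative group.\<close>

lemma torus_unitary: "torus 4 (unitary_torus_2 :: 'k :: field_char_0 alg_closure mat set)"
proof -
  let ?T = "unitary_torus_2 :: 'k alg_closure mat set"
  obtain i :: "'k alg_closure" where i: "i * i = -1" using obtain_sqrt_minus_one by blast
  let ?\<phi> = "eigen_block i" and ?\<psi> = "rot4_of_diagonal i"
  note circle = circle_parametrization[OF i]
  have \<phi>: "?\<phi> A \<in> diagonal_torus 2" if "A \<in> ?T" for A
    using that circle(3) by (auto simp: unitary_torus_2_iff diagonal_torus_2 eigen_block_rot4)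
  have \<psi>: "?\<psi> D \<in> ?T" if "D \<in> diagonal_torus 2" for D
  proof -
    have "D $$ (0, 0) \<noteq> 0" "D $$ (1, 1) \<noteq> 0" using that by (auto simp: diagonal_torus_2)
    from circle(1)[OF this(1)] circle(1)[OF this(2)] show ?thesis
      unfolding unitary_torus_2_iff rot4_of_diagonal_def Let_def by blast
  qed
  have \<psi>\<phi>: "?\<psi> (?\<phi> A) = A" if "A \<in> ?T" for A
  proof -
    obtain a b c d where "A = rot4 a b c d" "a * a + b * b = 1" "c * c + d * d = 1"
      using \<open>A \<in> ?T\<close> unfolding unitary_torus_2_iff by blast
    thus ?thesis
      by (simp only: rot4_of_diagonal_def Let_def eigen_block_rot4 circle(4,5))
  qed
  have \<phi>\<psi>: "?\<phi> (?\<psi> D) = D" if "D \<in> diagonal_torus 2" for D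
    using that unfolding diagonal_torus_2
    by (subst mat_eq_2)
      (simp_all only: all_less_2 rot4_of_diagonal_def Let_def eigen_block_rot4 circle(2) eigen_block_carrier simp_thms)
  have carr: "A \<in> carrier_mat 4 4" "A * J4 = J4 * A" if "A \<in> ?T" for A
    using that by (auto simp: unitary_torus_2_def orthogonal_centralizer_def)
  have \<phi>_mult: "?\<phi> (A * B) = ?\<phi> A * ?\<phi> B" if "A \<in> ?T" "B \<in> ?T" for A B
    using carr[OF that(1)] carr[OF that(2)] i by (intro eigen_block_mult) auto
  have T_mult: "A * B \<in> ?T" if "A \<in> ?T" "B \<in> ?T" for A B
    using subgroup.m_closed[OF subgroup_unitary(2) that] by simp
  have \<psi>_mult: "?\<psi> (D * E) = ?\<psi> D * ?\<psi> E" if "D \<in> diagonal_torus 2" "E \<in> diagonal_torus 2" for D E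
    using \<psi>\<phi>[OF T_mult[OF \<psi>[OF that(1)] \<psi>[OF that(2)]]]
      \<phi>_mult[OF \<psi>[OF that(1)] \<psi>[OF that(2)]] \<phi>\<psi> that by simp
  have "alg_hom UNIV 4 ?T 2 (diagonal_torus 2) ?\<phi>"
  proof -
    have "(\<lambda>A. A $$ (2 * r, 2 * s) + i * A $$ (2 * r + 1, 2 * s)) \<in> regular UNIV 4"
      if "r < 2" "s < 2" for r s
      using that by (intro regular.add regular.mult regular.entry regular.const) auto
    moreover have "eigen_block i A $$ (r, s) = A $$ (2 * r, 2 * s) + i * A $$ (2 * r + 1, 2 * s)"
      if "r < 2" "s < 2" for r s A
      using that by (simp add: eigen_block_def)
    ultimately have "\<exists>f\<in>regular UNIV 4. \<forall>A\<in>?T. ?\<phi> A $$ (r, s) = f A" if "r < 2" "s < 2" for r s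
      using that by (intro bexI[of _ "\<lambda>A. A $$ (2 * r, 2 * s) + i * A $$ (2 * r + 1, 2 * s)"]) auto
    thus ?thesis
      using \<phi> \<phi>_mult by (simp add: alg_hom_def hom_def)
  qed
  moreover have "alg_hom UNIV 2 (diagonal_torus 2) 4 ?T ?\<psi>"
  proof -
    \<comment> \<open>The inverse of a diagonal entry must be written through
      \<open>inverse (det D)\<close>: it is the other entry, at index \<open>1 - k\<close>, times
      the inverse determinant.\<close>
    define v where "v = (\<lambda>k D. D $$ (1 - k, 1 - k) * inverse (det D) :: 'k alg_closure)"
    define f where "f = (\<lambda>k D. 1/2 * (D $$ (k, k) + v k D) :: 'k alg_closure)"
    define g where "g = (\<lambda>k D. -i/2 * (D $$ (k, k) + (-1) * v k D) :: 'k alg_closure)"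
    have fg: "f k \<in> regular UNIV 2" "g k \<in> regular UNIV 2" if "k < 2" for k
      unfolding f_def g_def v_def using that
      by (intro regular.add regular.mult regular.entry regular.const regular.inv_det; simp)+
    have eq: "?\<psi> D = rot4 (f 0 D) (g 0 D) (f 1 D) (g 1 D)" if "D \<in> diagonal_torus 2" for D
    proof -
      have "inverse (D $$ (k, k)) = v k D" if "k = 0 \<or> k = 1" for k
        using that \<open>D \<in> diagonal_torus 2\<close> det_diagonal_torus_2[OF \<open>D \<in> diagonal_torus 2\<close>]
        unfolding diagonal_torus_2 v_def by auto
      thus ?thesis by (simp add: rot4_of_diagonal_def Let_def f_def g_def)
    qed
    have "\<exists>h\<in>regular UNIV 2. \<forall>D\<in>diagonal_torus 2. ?\<psi> D $$ (r, s) = h D" if "r < 4" "s < 4" for r s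
    proof -
      define h where "h = (\<lambda>D. rot4 (f 0 D) (g 0 D) (f 1 D) (g 1 D) $$ (r, s))"
      have neg: "(\<lambda>D. - F D) \<in> regular UNIV 2" if "F \<in> regular UNIV 2" for F :: "'k alg_closure mat \<Rightarrow> _"
        using regular.mult[OF regular.const[of "-1"] that] by simp
      have cases: "(\<lambda>D. if P then F D else F' D) \<in> regular UNIV 2"
        if "F \<in> regular UNIV 2" "F' \<in> regular UNIV 2" for P and F F' :: "'k alg_closure mat \<Rightarrow> _"
        using that by (cases P) simp_all
      have "h \<in> regular UNIV 2"
        unfolding h_def index_rot4[OF that]
        by (intro cases fg neg regular.const) auto
      with eq show ?thesis by (auto simp: h_def intro!: bexI[of _ h])
    qed
    thus ?thesis using \<psi> \<psi>_mult by (simp add: alg_hom_def hom_def)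
  qed
  ultimately show ?thesis
    unfolding torus_def using K_group_unitary(2) \<psi>\<phi> \<phi>\<psi> by blast
qed

section \<open>Sign cocycles\<close>

lemma Gal_field_hom: "\<gamma> \<in> Gal \<Longrightarrow> field_hom \<gamma>"
  by (simp add: Gal_def)

text \<open>Exponents turn products of cocycles into sums: \<open>a\<close> is (1, 0),
  \<open>b\<close> is (0, 1), \<open>a b\<close> is (1, 1), and (2, 0) is the square of
  \<open>a\<close>, a constant cocycle with value 1.\<close>

definition sign_cocycle :: "'k :: field_char_0 alg_closure \<Rightarrow> nat \<Rightarrow> nat \<Rightarrow> 'k cochain"
  where "sign_cocycle i k l = (\<lambda>\<gamma>\<in>Gal. D4 ((\<gamma> i / i) ^ k) ((\<gamma> i / i) ^ l))"

context
  fixes i :: "'k :: field_char_0 alg_closure"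
  assumes i: "i * i = -1"
begin

lemma Gal_sqrt_minus_one:
  assumes "\<gamma> \<in> Gal" shows "\<gamma> i / i = 1 \<or> \<gamma> i / i = -1"
proof -
  interpret field_hom \<gamma> using assms by (rule Gal_field_hom)
  have "\<gamma> i * \<gamma> i = \<gamma> (i * i)" by (simp only: hom_mult)
  also have "\<dots> = i * i" by (simp add: i hom_uminus)
  finally have "\<gamma> i = i \<or> \<gamma> i = - i" by (simp only: square_eq_iff)
  moreover have "i \<noteq> 0" using i by auto
  ultimately show ?thesis by auto
qed

lemma Gal_sign_square: "\<gamma> \<in> Gal \<Longrightarrow> (\<gamma> i / i) ^ k * (\<gamma> i / i) ^ k = 1"
proof -
  assume "\<gamma> \<in> Gal"
  moreover have "x ^ k * x ^ k = 1" if "x = 1 \<or> x = -1" for x :: "'k alg_closure"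
    using that by (auto simp flip: power_mult_distrib)
  ultimately show ?thesis using Gal_sqrt_minus_one by blast
qed

lemma map_mat_D4:
  assumes "\<gamma> \<in> Gal" "\<gamma>' \<in> Gal"
  shows "map_mat \<gamma>' (D4 ((\<gamma> i / i) ^ k) ((\<gamma> i / i) ^ l)) = D4 ((\<gamma> i / i) ^ k) ((\<gamma> i / i) ^ l)"
proof -
  interpret field_hom \<gamma>' using assms(2) by (rule Gal_field_hom)
  have "\<gamma>' (x ^ m) = x ^ m" if "x = 1 \<or> x = -1" for x m
    using that by (auto simp: hom_distribs)
  hence "\<gamma>' ((\<gamma> i / i) ^ m) = (\<gamma> i / i) ^ m" for m
    using Gal_sqrt_minus_one[OF assms(1)] by blast
  thus ?thesis by (subst mat_eq_4) (simp_all add: all_less_4)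
qed

lemma map_mat_W4: "\<gamma> \<in> Gal \<Longrightarrow> map_mat \<gamma> W4 = W4"
proof -
  assume "\<gamma> \<in> Gal"
  then interpret field_hom \<gamma> by (rule Gal_field_hom)
  show ?thesis by (subst mat_eq_4) (simp_all add: all_less_4)
qed

lemma Gal_comp: "\<gamma> \<in> Gal \<Longrightarrow> \<gamma>' \<in> Gal \<Longrightarrow> \<gamma> \<circ> \<gamma>' \<in> (Gal :: ('k alg_closure \<Rightarrow> _) set)"
proof -
  assume "\<gamma> \<in> Gal" "\<gamma>' \<in> (Gal :: ('k alg_closure \<Rightarrow> _) set)"
  moreover from this interpret \<gamma>: field_hom \<gamma> by (auto intro: Gal_field_hom)
  from calculation interpret \<gamma>': field_hom \<gamma>' by (auto intro: Gal_field_hom)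
  have "field_hom (\<gamma> \<circ> \<gamma>')"
    by unfold_locales (simp_all add: \<gamma>.hom_add \<gamma>.hom_mult \<gamma>'.hom_add \<gamma>'.hom_mult)
  ultimately show ?thesis by (auto simp: Gal_def bij_comp)
qed

lemma sign_cocycle_in_torus: "sign_cocycle i k l \<in> cocycles unitary_torus_2"
proof -
  have "i \<noteq> 0" using i by auto
  have "sign_cocycle i k l \<in> Gal \<rightarrow>\<^sub>E unitary_torus_2"
    by (auto simp: sign_cocycle_def Gal_sign_square intro!: D4_in_torus)
  moreover have "locally_constant (sign_cocycle i k l)"
    \<comment> \<open>The value at \<open>\<gamma>\<close> depends only on
      \<open>\<gamma> i\<close>.\<close>
    unfolding locally_constant_def by (auto simp: sign_cocycle_def intro!: exI[of _ "{i}"])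
  moreover have "sign_cocycle i k l (\<gamma>\<^sub>1 \<circ> \<gamma>\<^sub>2) =
      sign_cocycle i k l \<gamma>\<^sub>1 * map_mat \<gamma>\<^sub>1 (sign_cocycle i k l \<gamma>\<^sub>2)" if \<gamma>: "\<gamma>\<^sub>1 \<in> Gal" "\<gamma>\<^sub>2 \<in> Gal" for \<gamma>\<^sub>1 \<gamma>\<^sub>2
  proof -
    interpret field_hom \<gamma>\<^sub>1 using \<gamma>(1) by (rule Gal_field_hom)
    have "\<gamma>\<^sub>2 i = i \<or> \<gamma>\<^sub>2 i = - i"
      using Gal_sqrt_minus_one[OF \<gamma>(2)] \<open>i \<noteq> 0\<close> by (auto simp: field_simps)
    \<comment> \<open>The signs are fixed by Galois, so the sign is a character and the cocycle
      condition is its multiplicativity.\<close>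
    hence "\<gamma>\<^sub>1 (\<gamma>\<^sub>2 i) / i = (\<gamma>\<^sub>1 i / i) * (\<gamma>\<^sub>2 i / i)"
      using \<open>i \<noteq> 0\<close> by (auto simp: hom_distribs)
    thus ?thesis
      using \<gamma> Gal_comp[OF \<gamma>]
      by (simp add: sign_cocycle_def map_mat_D4 D4_mult power_mult_distrib del: times_divide_eq_left times_divide_eq_right)
  qed
  ultimately show ?thesis by (simp add: cocycles_def)
qed

lemma cocycle_mult_sign:
  "cocycle_mult (sign_cocycle i k l) (sign_cocycle i k' l') = sign_cocycle i (k + k') (l + l')"
  by (auto simp: cocycle_mult_def sign_cocycle_def D4_mult power_add restrict_def)

text \<open>\<open>W4\<close> is fixed by Galois, so twisting by it is plain conjugation, which
  exchanges the two coordinates.\<close>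

lemma sign_cocycle_swap: "(sign_cocycle i k l, sign_cocycle i l k) \<in> cohomologous 4 unitary_group_2"
proof -
  have "sign_cocycle i k l \<in> cocycles unitary_group_2" for k l
    using sign_cocycle_in_torus[of k l] torus_subset_group unfolding cocycles_def by fastforce
  moreover have "sign_cocycle i l k \<gamma> = inv\<^bsub>GL 4\<^esub> W4 * sign_cocycle i k l \<gamma> * map_mat \<gamma> W4"
    if "\<gamma> \<in> Gal" for \<gamma>
    using that
    by (simp add: sign_cocycle_def inv_unitary[OF W4_in_group] transpose_4 map_mat_W4 W4_conjugate_D4)
  ultimately show ?thesis using W4_in_group by (auto simp: cohomologous_def)
qed

text \<open>A matrix trivializing the difference would be multiplied by -1 by complex conjugation, so
  its first column would be a purely imaginary vector whose entries have squares summing to 1.\<close>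

lemma sign_cocycles_not_cohomologous:
  fixes \<sigma> :: "'k \<Rightarrow> real"
  assumes "field_hom \<sigma>"
  shows "(sign_cocycle i 2 0, sign_cocycle i 1 1) \<notin> cohomologous 4 unitary_group_2"
proof
  assume "(sign_cocycle i 2 0, sign_cocycle i 1 1) \<in> cohomologous 4 unitary_group_2"
  then obtain g where g: "g \<in> unitary_group_2"
    and eq: "\<And>\<gamma>. \<gamma> \<in> Gal \<Longrightarrow>
      sign_cocycle i 1 1 \<gamma> = inv\<^bsub>GL 4\<^esub> g * sign_cocycle i 2 0 \<gamma> * map_mat \<gamma> g"
    by (auto simp: cohomologous_def)
  have "\<exists>\<tau> :: 'k alg_closure \<Rightarrow> complex. \<exists>\<gamma>\<in>Gal. field_hom \<tau> \<and> (\<forall>x. \<tau> (\<gamma> x) = cnj (\<tau> x))"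
    by (rule obtain_complex_conjugation[OF assms]) blast
  then obtain \<tau> :: "'k alg_closure \<Rightarrow> complex" and \<gamma>
    where \<tau>: "field_hom \<tau>" and \<gamma>: "\<gamma> \<in> Gal" and \<tau>\<gamma>: "\<And>x. \<tau> (\<gamma> x) = cnj (\<tau> x)"
    by blast
  interpret \<tau>: field_hom \<tau> by (rule \<tau>)
  have gc: "g \<in> carrier_mat 4 4" "transpose_mat g * g = 1\<^sub>m 4"
    using g by (auto simp: in_unitary_group_2)
  have gg: "g * transpose_mat g = 1\<^sub>m 4"
    using mat_mult_left_right_inverse[of "transpose_mat g" 4 g] gc by simp
  have "i \<noteq> 0" using i by auto
  have "\<tau> i * \<tau> i = -1" using arg_cong[OF i, of \<tau>] by (simp add: \<tau>.hom_mult \<tau>.hom_uminus)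
  hence "(\<tau> i)\<^sup>2 = \<i>\<^sup>2" by (simp add: power2_eq_square)
  hence "\<tau> i = \<i> \<or> \<tau> i = -\<i>" by (simp only: power2_eq_iff)
  \<comment> \<open>Conjugation negates both complex square roots of -1, so it does not matter which
    of them is \<open>\<tau> i\<close>.\<close>
  hence "\<tau> (\<gamma> i) = \<tau> (- i)" by (auto simp: \<tau>\<gamma> \<tau>.hom_uminus)
  hence "\<gamma> i / i = -1" using \<open>i \<noteq> 0\<close> by (simp add: field_simps)
  \<comment> \<open>With exponents 2 and 0 the cocycle has value 1 at \<open>\<gamma>\<close>, so
    only \<open>g\<close> and its Galois image remain.\<close>
  hence "D4 (-1) (-1) = transpose_mat g * map_mat \<gamma> g"
    using eq[OF \<gamma>] \<gamma> gc by (simp add: sign_cocycle_def inv_unitary[OF g] D4_one)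
  hence "g * D4 (-1) (-1) = g * (transpose_mat g * map_mat \<gamma> g)" by simp
  also have "\<dots> = g * transpose_mat g * map_mat \<gamma> g"
    using gc by (intro assoc_mult_mat[symmetric]) auto
  finally have gD: "g * D4 (-1) (-1) = map_mat \<gamma> g" using gc by (simp add: gg)
  have sq: "Re (\<tau> (g $$ (r, 0)) * \<tau> (g $$ (r, 0))) \<le> 0" if "r < 4" for r
  proof -
    have "\<gamma> (g $$ (r, 0)) = - g $$ (r, 0)"
      using arg_cong[OF gD, of "\<lambda>M. M $$ (r, 0)"] that gc by (simp add: mult_mat_4)
    hence "cnj (\<tau> (g $$ (r, 0))) = - \<tau> (g $$ (r, 0))"
      using \<tau>\<gamma>[of "g $$ (r, 0)"] by (simp add: \<tau>.hom_uminus)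
    hence "Re (\<tau> (g $$ (r, 0))) = 0" by (auto simp: complex_eq_iff)
    thus ?thesis by simp
  qed
  have "g $$ (0, 0) * g $$ (0, 0) + g $$ (1, 0) * g $$ (1, 0) + g $$ (2, 0) * g $$ (2, 0) +
      g $$ (3, 0) * g $$ (3, 0) = 1"
    using arg_cong[OF gc(2), of "\<lambda>M. M $$ (0, 0)"] gc(1) by (simp add: mult_mat_4)
  from arg_cong[OF this, of "\<lambda>x. Re (\<tau> x)"] sq[of 0] sq[of 1] sq[of 2] sq[of 3]
  show False by (simp add: \<tau>.hom_add \<tau>.hom_mult)
qed

end

theorem theorem1p3:
  assumes "is_real_field TYPE('k :: field_char_0) \<or>
    (is_number_field TYPE('k) \<and> has_real_embedding TYPE('k))"
  shows "\<not> (\<exists>M :: nat \<Rightarrow> 'k alg_closure mat set \<Rightarrow> 'k cochain set monoid.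
    functorial_group_structure M)"
proof
  assume "\<exists>M :: nat \<Rightarrow> 'k alg_closure mat set \<Rightarrow> 'k cochain set monoid. functorial_group_structure M"
  then obtain M :: "nat \<Rightarrow> 'k alg_closure mat set \<Rightarrow> 'k cochain set monoid"
    where M: "functorial_group_structure M" by blast
  obtain \<sigma> :: "'k \<Rightarrow> real" where \<sigma>: "field_hom \<sigma>"
    using assms by (auto simp: is_real_field_def has_real_embedding_def)
  obtain i :: "'k alg_closure" where i: "i * i = -1" using obtain_sqrt_minus_one by blast
  note mult = cocycle_mult_sign[OF i] and cocycle = sign_cocycle_in_torus[OF i]
  \<comment> \<open>The unevaluated sums let the cocycles be read as the products \<open>a a\<close>
    and \<open>a b\<close>.\<close>
  have "(sign_cocycle i (1 + 1) (0 + 0), sign_cocycle i (1 + 0) (0 + 1)) \<in> cohomologous 4 unitary_group_2"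
    unfolding mult[symmetric]
    by (rule functorial_group_structure_cohomologous[OF M reductive_unitary(2) torus_unitary
          reductive_unitary(1) torus_subset_group])
      (simp_all only: cocycle mult sign_cocycle_swap[OF i])
  thus False using sign_cocycles_not_cohomologous[OF i \<sigma>] by simp
qed

end
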